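(* Let $\alpha\in\operatorname{D}^\sigma_\pi$ with $\sigma\in[0,1)$. There is a constant $c$ such that $$\|u\|_{\operatorname{L}^2_\pi(B)}\le c\,\|\sqrt{\alpha}\,\nabla u\|_{\operatorname{L}^2_\pi(B)},\quad u\in\operatorname{H}^1_{\pi,\alpha,0}(B),$$ where $$\operatorname{H}^1_{\pi,\alpha,0}(B)=\Big\{u\in\operatorname{H}^1_{\pi,\alpha}(B)\,\Big|\,\int_Bu(x)\,dx=0\Big\}.$$
   Context: Let $n\in\{1,2\}$ and let $B=[-1,1)^n$ be the periodicity box: functions on $B$ are identified with functions on $\mathbb{R}^n$ that are $2$-periodic in each variable, and the subscript $\pi$ indicates spaces of periodic functions. If $n=1$, $\Gamma=\{-1/2,1/2\}$; if $n=2$, $\Gamma\subset B$ is a smooth closed curve bounding a smooth domain $\Omega$. Put $d(x,\Gamma)=\inf_{y\in\Gamma}|x-y|$. For $\sigma\in[0,1)$, $\operatorname{D}^\sigma_\pi$ is the set of bounded periodic functions $\alpha:B\to[0,\infty)$ which vanish exactly on $\Gamma$ (no vanishing is required if $\sigma=0$), satisfy $\frac1c d(x,\Gamma)^\sigma\le\alpha(x)\le c\,d(x,\Gamma)^\sigma$ for $x\in B$ and some constant $1\le c<\infty$, and are otherwise smooth on $B\setminus\Gamma$ (at least Hölder continuous of exponent $\sigma$). $\operatorname{H}^1_{\pi,\alpha}(B)=\{u\in\operatorname{L}^2_\pi(B): |\nabla u|\in\operatorname{L}^1_\pi(B),\ \int_B\alpha|\nabla u|^2dx<\infty\}$ (distributional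 periodic gradient), with norm $(\|u\|_2^2+\|\sqrt\alpha\,\nabla u\|_2^2)^{1/2}$. *)

theory Defs
  imports "HOL-Analysis.Analysis"
begin

section \<open>Periodic functions\<close>

text \<open>
  Functions on the periodicity box are represented by 2-periodic functions on the whole space
  \<open>real ^ 'n\<close>; elements of Lebesgue spaces are represented by everywhere periodic functions
  (every class has such a representative).
\<close>

definition pbox :: "(real ^ 'n) set" where
  "pbox = {x. \<forall>i. -1 \<le> x $ i \<and> x $ i < 1}"

definition periodic :: "(real ^ 'n \<Rightarrow> 'b) \<Rightarrow> bool" where
  "periodic f \<longleftrightarrow> (\<forall>x i. f (x + axis i 2) = f x)"

text \<open>All translates of a subset of the box by the period lattice.\<close>

definition periodic_copies :: "(real ^ 'n) set \<Rightarrow> (real ^ 'n) set" where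
  "periodic_copies S = {x. \<exists>k :: 'n \<Rightarrow> int. x + (\<chi> i. 2 * real_of_int (k i)) \<in> S}"


section \<open>Smoothness\<close>

primrec Ck :: "nat \<Rightarrow> ('a::euclidean_space \<Rightarrow> 'b::real_normed_vector) \<Rightarrow> bool" where
  "Ck 0 f \<longleftrightarrow> continuous_on UNIV f"
| "Ck (Suc k) f \<longleftrightarrow>
     (\<forall>x. f differentiable (at x)) \<and> (\<forall>v. Ck k (\<lambda>x. frechet_derivative f (at x) v))"

definition smooth :: "('a::euclidean_space \<Rightarrow> 'b::real_normed_vector) \<Rightarrow> bool" where
  "smooth f \<longleftrightarrow> (\<forall>k. Ck k f)"

text \<open>
  Continuity is part of local Hoelder continuity so that exponent 0 means plain continuity.
\<close>

definition locally_hoelder_on ::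
    "('a::euclidean_space) set \<Rightarrow> real \<Rightarrow> ('a \<Rightarrow> real) \<Rightarrow> bool" where
  "locally_hoelder_on S \<sigma> f \<longleftrightarrow>
     continuous_on S f \<and>
     (\<forall>K. compact K \<and> K \<subseteq> S \<longrightarrow>
        (\<exists>C. \<forall>x\<in>K. \<forall>y\<in>K. \<bar>f x - f y\<bar> \<le> C * dist x y powr \<sigma>))"


section \<open>The degeneracy set and the weights\<close>

text \<open>Regular, simple, smooth closed curves.\<close>

definition smooth_closed_curve :: "('a::euclidean_space) set \<Rightarrow> bool" where
  "smooth_closed_curve \<Gamma> \<longleftrightarrow>
     (\<exists>\<gamma> :: real \<Rightarrow> 'a.
        smooth \<gamma> \<and> (\<forall>t. \<gamma> (t + 1) = \<gamma> t) \<and> inj_on \<gamma> {0..<1} \<and>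
        (\<forall>t. vector_derivative \<gamma> (at t) \<noteq> 0) \<and> \<Gamma> = \<gamma> ` {0..<1})"

text \<open>
  In dimension two, \<open>\<Gamma>\<close> is the whole boundary of the bounded domain \<open>\<Omega>\<close>; the smoothness of the
  domain is the smoothness of this boundary curve.
\<close>

definition degeneracy_set :: "(real ^ 'n) set \<Rightarrow> bool" where
  "degeneracy_set \<Gamma> \<longleftrightarrow>
     (CARD('n) = 1 \<longrightarrow> \<Gamma> = {vec (-1/2), vec (1/2)}) \<and>
     (CARD('n) = 2 \<longrightarrow>
        \<Gamma> \<subseteq> pbox \<and> smooth_closed_curve \<Gamma> \<and>
        (\<exists>\<Omega>. \<Omega> \<noteq> {} \<and> open \<Omega> \<and> connected \<Omega> \<and> bounded \<Omega> \<and> frontier \<Omega> = \<Gamma>))"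

text \<open>
  The power of the distance to \<open>\<Gamma>\<close>. The exponent 0 is separate because \<open>0 powr 0 = 0\<close>, whereas
  the zeroth power of the distance has to be 1 on \<open>\<Gamma>\<close> as well.
\<close>

definition dist_pow :: "('a::euclidean_space) set \<Rightarrow> real \<Rightarrow> 'a \<Rightarrow> real" where
  "dist_pow \<Gamma> \<sigma> x = (if \<sigma> = 0 then 1 else infdist x \<Gamma> powr \<sigma>)"

text \<open>
  ``Smooth off \<open>\<Gamma>\<close>, at least Hoelder continuous of exponent \<open>\<sigma>\<close>'' is rendered by the least
  regularity it grants: local Hoelder continuity away from the periodic copies of \<open>\<Gamma>\<close>.
\<close>

definition D_per :: "(real ^ 'n) set \<Rightarrow> real \<Rightarrow> (real ^ 'n \<Rightarrow> real) set" where
  "D_per \<Gamma> \<sigma> =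
     {\<alpha>. periodic \<alpha> \<and> bounded (range \<alpha>) \<and> (\<forall>x. 0 \<le> \<alpha> x) \<and>
          (\<sigma> \<noteq> 0 \<longrightarrow> (\<forall>x\<in>pbox. \<alpha> x = 0 \<longleftrightarrow> x \<in> \<Gamma>)) \<and>
          (\<exists>c\<ge>1. \<forall>x\<in>pbox. 1 / c * dist_pow \<Gamma> \<sigma> x \<le> \<alpha> x \<and> \<alpha> x \<le> c * dist_pow \<Gamma> \<sigma> x) \<and>
          locally_hoelder_on (- periodic_copies \<Gamma>) \<sigma> \<alpha>}"


section \<open>Function spaces\<close>

definition L2_per :: "(real ^ 'n \<Rightarrow> 'b::euclidean_space) set" where
  "L2_per = {f. periodic f \<and> f \<in> borel_measurable lebesgue \<and>
                set_integrable lebesgue pbox (\<lambda>x. (norm (f x))\<^sup>2)}"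

definition L2_norm :: "(real ^ 'n \<Rightarrow> 'b::euclidean_space) \<Rightarrow> real" where
  "L2_norm f = sqrt (LINT x:pbox|lebesgue. (norm (f x))\<^sup>2)"

definition L1_per :: "(real ^ 'n \<Rightarrow> 'b::euclidean_space) set" where
  "L1_per = {f. periodic f \<and> f \<in> borel_measurable lebesgue \<and> set_integrable lebesgue pbox f}"

text \<open>\<open>g\<close> is the distributional gradient of \<open>u\<close> on the torus, and it is an integrable function.\<close>

definition has_periodic_gradient ::
    "(real ^ 'n \<Rightarrow> real) \<Rightarrow> (real ^ 'n \<Rightarrow> real ^ 'n) \<Rightarrow> bool" where
  "has_periodic_gradient u g \<longleftrightarrow>
     g \<in> L1_per \<and>
     (\<forall>\<phi> :: real ^ 'n \<Rightarrow> real. smooth \<phi> \<and> periodic \<phi> \<longrightarrow>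
        (\<forall>i. (LINT x:pbox|lebesgue. u x * frechet_derivative \<phi> (at x) (axis i 1)) =
             - (LINT x:pbox|lebesgue. g x $ i * \<phi> x)))"

text \<open>The gradient is unique up to a null set; one representative is chosen.\<close>

definition periodic_gradient :: "(real ^ 'n \<Rightarrow> real) \<Rightarrow> real ^ 'n \<Rightarrow> real ^ 'n" where
  "periodic_gradient u = (SOME g. has_periodic_gradient u g)"

definition H1_per :: "(real ^ 'n \<Rightarrow> real) \<Rightarrow> (real ^ 'n \<Rightarrow> real) set" where
  "H1_per \<alpha> =
     {u \<in> L2_per. (\<exists>g. has_periodic_gradient u g) \<and>
        set_integrable lebesgue pbox (\<lambda>x. \<alpha> x * (norm (periodic_gradient u x))\<^sup>2)}"

definition H1_per_0 :: "(real ^ 'n \<Rightarrow> real) \<Rightarrow> (real ^ 'n \<Rightarrow> real) set" where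
  "H1_per_0 \<alpha> = {u \<in> H1_per \<alpha>. (LINT x:pbox|lebesgue. u x) = 0}"

end

theory Submission imports Defs
begin

text \<open>
  By Cauchy--Schwarz, \<open>(\<integral>|\<nabla>u|)\<^sup>2\<close> is at most \<open>\<integral>1/\<alpha>\<close> times \<open>\<integral>\<alpha>|\<nabla>u|\<^sup>2\<close>, and \<open>1/\<alpha>\<close> is integrable because
  the \<open>\<epsilon>\<close>-neighbourhood of \<open>\<Gamma>\<close> has measure \<open>O(\<epsilon>)\<close> and \<open>\<sigma> < 1\<close>. This leaves the estimate of the
  \<open>L\<^sup>2\<close> norm of \<open>u\<close> by the \<open>L\<^sup>1\<close> norm of its gradient, which is critical in dimension two.

  For it, the weak gradient is tested with products of smoothed indicator functions and of
  periodic antiderivatives of such functions minus their mean. In dimension two this bounds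
  \<open>\<integral>u\<close> over a rectangle \<open>I \<times> J\<close> by \<open>|I| \<integral>|\<nabla>u| + |I| |J| \<parallel>\<nabla>u\<parallel>\<^sub>1 / 2\<close>, the first integral being over the strip
  of all points with second coordinate in \<open>J\<close>. As rectangles determine an integrable function
  almost everywhere, \<open>|u(s,t)|\<close> is at most a function \<open>G(t)\<close> with integral \<open>2 \<parallel>\<nabla>u\<parallel>\<^sub>1\<close>, and by symmetry at
  most some \<open>G'(s)\<close>; integrate \<open>u\<^sup>2 \<le> G'(s) G(t)\<close>.
\<close>

section \<open>Box integrals\<close>

text \<open>
  By Henstock's lemma, the boxes of a fine cover tagged in the set where \<open>f < -\<delta>\<close> have small total
  measure, since each of them contributes at least \<open>\<delta>\<close> times its measure to the error.
\<close>

lemma negligible_negative_part: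
  fixes f :: "'a::euclidean_space \<Rightarrow> real"
  assumes f: "f integrable_on cbox a b"
    and nonneg: "\<And>c d. cbox c d \<subseteq> cbox a b \<Longrightarrow> 0 \<le> integral (cbox c d) f"
  shows "negligible {x \<in> cbox a b. f x < 0}"
proof (cases "box a b = {}")
  case True
  then have "negligible (cbox a b)"
    by (simp add: negligible_interval)
  then show ?thesis
    by (rule negligible_subset) auto
next
  case False
  have level: "negligible {x \<in> cbox a b. f x < - \<delta>}" (is "negligible ?E") if "\<delta> > 0" for \<delta>
    unfolding negligible_outer_le
  proof (intro allI impI)
    fix e :: real
    assume "e > 0"
    with \<open>\<delta> > 0\<close> have "e * \<delta> > 0" by simp
    \<comment> \<open>The tolerance is \<open>e * \<delta>\<close> because each tagged box will
      contribute at least \<delta> times its measure; dividing by \<delta> leaves the required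
      \<open>e\<close>.\<close>
    obtain g where g: "gauge g"
      and henstock: "\<And>p. \<lbrakk>p tagged_partial_division_of cbox a b; g fine p\<rbrakk>
          \<Longrightarrow> (\<Sum>(x,K)\<in>p. norm (measure lborel K *\<^sub>R f x - integral K f)) < e * \<delta>"
      by (rule Henstock_lemma[OF f \<open>e * \<delta> > 0\<close>]) (rule that)
    have sub: "?E \<subseteq> cbox a b" by auto
    obtain D where D: "countable D" "\<Union>D \<subseteq> cbox a b"
      and Dbox: "\<And>K. K \<in> D \<Longrightarrow> interior K \<noteq> {} \<and> (\<exists>c d. K = cbox c d)"
      and disj: "pairwise (\<lambda>A B. interior A \<inter> interior B = {}) D"
      and tag: "\<And>K. K \<in> D \<Longrightarrow> \<exists>x \<in> ?E \<inter> K. K \<subseteq> g x"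
      and "\<And>u v. cbox u v \<in> D \<Longrightarrow> \<exists>n. \<forall>i \<in> Basis. v \<bullet> i - u \<bullet> i = (b \<bullet> i - a \<bullet> i) / 2^n"
      and cover: "?E \<subseteq> \<Union>D"
      by (rule covering_lemma[OF sub False g]) (rule that)
    obtain t where t: "\<And>K. K \<in> D \<Longrightarrow> t K \<in> ?E \<inter> K \<and> K \<subseteq> g (t K)"
      using tag by metis
    \<comment> \<open>The cover \<open>D\<close> may be infinite, whereas Henstock's lemma speaks of
      finite partial divisions. The bound is therefore proved uniformly for finite subfamilies and
      passed to the countable union afterwards.\<close>
    have fin: "(\<Sum>K\<in>F. measure lborel K) \<le> e" if F: "finite F" "F \<subseteq> D" for F
    proof -
      let ?p = "(\<lambda>K. (t K, K)) ` F"
      have inj: "inj_on (\<lambda>K. (t K, K)) F"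
        by (auto simp: inj_on_def)
      have K: "t K \<in> K" "K \<subseteq> cbox a b" "\<exists>c d. K = cbox c d" if "K \<in> F" for K
        proof -
        have "K \<in> D" using F that by auto
        then show "t K \<in> K" "K \<subseteq> cbox a b" "\<exists>c d. K = cbox c d"
          using t[of K] Dbox[of K] D(2) by auto
      qed
      have "interior K \<inter> interior L = {}" if "K \<in> F" "L \<in> F" "K \<noteq> L" for K L
        using disj F that by (auto simp: pairwise_def)
      then have "?p tagged_partial_division_of cbox a b"
        unfolding tagged_partial_division_of_def using F K
        by (intro conjI allI impI) (auto simp: image_iff)
      moreover have "g fine ?p"
        using t F by (auto simp: fine_def)
      ultimately have "(\<Sum>(x,K)\<in>?p. norm (measure lborel K *\<^sub>R f x - integral K f)) < e * \<delta>"
        by (rule henstock)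
      then have less: "(\<Sum>K\<in>F. norm (measure lborel K *\<^sub>R f (t K) - integral K f)) < e * \<delta>"
        by (simp add: sum.reindex[OF inj] o_def)
      have "\<delta> * measure lborel K \<le> norm (measure lborel K *\<^sub>R f (t K) - integral K f)" if "K \<in> F" for K
      proof -
        have "K \<in> D" using that F by auto
        then obtain c d where cd: "K = cbox c d" "cbox c d \<subseteq> cbox a b"
          using Dbox D by (metis Union_upper subset_trans)
        have "0 \<le> integral K f" using nonneg cd by auto
        moreover have "measure lborel K * f (t K) \<le> measure lborel K * (- \<delta>)"
          using t[OF \<open>K \<in> D\<close>] by (intro mult_left_mono) auto
        ultimately show ?thesis
          by (simp add: mult.commute abs_if)
      qed
      then have "\<delta> * (\<Sum>K\<in>F. measure lborel K) \<le> (\<Sum>K\<in>F. norm (measure lborel K *\<^sub>R f (t K) - integral K f))"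
        by (simp add: sum_distrib_left sum_mono)
      with less have "\<delta> * (\<Sum>K\<in>F. measure lborel K) \<le> \<delta> * e"
        by (simp add: mult.commute)
      then show ?thesis using \<open>\<delta> > 0\<close> by simp
    qed
    have Dmeas: "K \<in> lmeasurable" if "K \<in> D" for K
      using Dbox[OF that] by auto
    have Fle: "measure lebesgue (\<Union>K\<in>F. K) \<le> e" if F: "F \<subseteq> D" "finite F" for F
    proof -
      have "measure lebesgue (\<Union>K\<in>F. K) \<le> (\<Sum>K\<in>F. measure lebesgue K)"
        using F Dmeas by (intro measure_UNION_le) auto
      also have "\<dots> = (\<Sum>K\<in>F. measure lborel K)"
      proof (intro sum.cong refl)
        fix K assume "K \<in> F"
        then obtain c d where "K = cbox c d" using F Dbox by blast
        then show "measure lebesgue K = measure lborel K" by simp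
      qed
      also have "\<dots> \<le> e" using fin F by auto
      finally show ?thesis .
    qed
    have "\<Union>D \<in> lmeasurable \<and> measure lebesgue (\<Union>D) \<le> e"
      using fmeasurable_UN_bound[OF D(1) Dmeas Fle] measure_UN_bound[OF D(1) Dmeas Fle] by simp
    then show "\<exists>T. ?E \<subseteq> T \<and> T \<in> lmeasurable \<and> measure lebesgue T \<le> e"
      using cover by blast
  qed
  \<comment> \<open>By the Archimedean property the set where \<open>f\<close> is negative is
    exhausted by countably many of the level sets just treated.\<close>
  have "{x \<in> cbox a b. f x < 0} = (\<Union>n::nat. {x \<in> cbox a b. f x < - inverse (real (Suc n))})"
  proof (safe, simp_all)
    fix x assume "f x < 0"
    then obtain n :: nat where "inverse (real (Suc n)) < - f x"
      using reals_Archimedean[of "- f x"] by auto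
    then show "\<exists>n::nat. f x < - inverse (1 + real n)"
      by (intro exI[of _ n]) simp
  next
    fix x and n :: nat assume "f x < - inverse (1 + real n)"
    moreover have "inverse (1 + real n) > 0" by simp
    ultimately show "f x < 0" by linarith
  qed
  moreover have "negligible \<dots>"
    by (intro negligible_countable_Union) (auto intro!: level)
  ultimately show ?thesis by simp
qed

section \<open>Smooth periodic test functions\<close>

text \<open>
  The class contains its own directional derivatives. The last rule is there for antiderivatives
  that have no closed form.
\<close>

inductive elementary :: "(real ^ 'n \<Rightarrow> real) \<Rightarrow> bool" where
  elementary_const: "elementary (\<lambda>x. c)"
| elementary_coord: "elementary (\<lambda>x. x $ i)"
| elementary_add: "elementary f \<Longrightarrow> elementary g \<Longrightarrow> elementary (\<lambda>x. f x + g x)"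
| elementary_mult: "elementary f \<Longrightarrow> elementary g \<Longrightarrow> elementary (\<lambda>x. f x * g x)"
| elementary_sin: "elementary f \<Longrightarrow> elementary (\<lambda>x. sin (f x))"
| elementary_cos: "elementary f \<Longrightarrow> elementary (\<lambda>x. cos (f x))"
| elementary_exp: "elementary f \<Longrightarrow> elementary (\<lambda>x. exp (f x))"
| elementary_inverse: "elementary f \<Longrightarrow> (\<And>x. f x \<noteq> 0) \<Longrightarrow> elementary (\<lambda>x. inverse (f x))"
| elementary_antiderivative: "(\<And>t. (F has_real_derivative h t) (at t)) \<Longrightarrow> elementary (\<lambda>x. h (x $ i))
    \<Longrightarrow> elementary (\<lambda>x. F (x $ i))"

lemma elementary_minus: "elementary f \<Longrightarrow> elementary (\<lambda>x. - f x)"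
  using elementary_mult[OF elementary_const[of "-1"], of f] by simp

lemma elementary_diff: "elementary f \<Longrightarrow> elementary g \<Longrightarrow> elementary (\<lambda>x. f x - g x)"
  using elementary_add[OF _ elementary_minus, of f g] by simp

text \<open>Structural induction with the usual differentiation rules. The direction
  \<open>v\<close> is held fixed and the base point varies, since this is the form in which
  \<open>Ck\<close> iterates derivatives; closure under this operation yields smoothness of every
  order.\<close>

lemma elementary_has_derivative:
  fixes f :: "real ^ 'n \<Rightarrow> real"
  assumes "elementary f"
  shows "\<exists>f'. (\<forall>x. (f has_derivative f' x) (at x)) \<and> (\<forall>v. elementary (\<lambda>x. f' x v))"
  using assms
proof induction
  case (elementary_const c)
  show ?case
    by (intro exI[of _ "\<lambda>x v. 0"]) (simp add: elementary.elementary_const)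
next
  case (elementary_coord i)
  show ?case
    by (intro exI[of _ "\<lambda>x v. v $ i"]) (auto intro!: elementary.elementary_const bounded_linear_imp_has_derivative)
next
  case (elementary_add f g)
  then obtain f' g' where "\<And>x. (f has_derivative f' x) (at x)" "\<And>v. elementary (\<lambda>x. f' x v)"
    "\<And>x. (g has_derivative g' x) (at x)" "\<And>v. elementary (\<lambda>x. g' x v)"
    by metis
  then show ?case
    by (intro exI[of _ "\<lambda>x v. f' x v + g' x v"])
      (auto intro!: elementary.elementary_add has_derivative_add)
next
  case (elementary_mult f g)
  then obtain f' g' where "\<And>x. (f has_derivative f' x) (at x)" "\<And>v. elementary (\<lambda>x. f' x v)"
    "\<And>x. (g has_derivative g' x) (at x)" "\<And>v. elementary (\<lambda>x. g' x v)"
    by metis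
  with elementary_mult.hyps show ?case
    by (intro exI[of _ "\<lambda>x v. f x * g' x v + f' x v * g x"])
      (auto intro!: elementary.elementary_add elementary.elementary_mult has_derivative_mult)
next
  case (elementary_sin f)
  then obtain f' where "\<And>x. (f has_derivative f' x) (at x)" "\<And>v. elementary (\<lambda>x. f' x v)"
    by metis
  with elementary_sin.hyps show ?case
    by (intro exI[of _ "\<lambda>x v. f' x v * cos (f x)"])
      (auto intro!: elementary.elementary_cos elementary.elementary_mult has_derivative_sin)
next
  case (elementary_cos f)
  then obtain f' where "\<And>x. (f has_derivative f' x) (at x)" "\<And>v. elementary (\<lambda>x. f' x v)"
    by metis
  with elementary_cos.hyps show ?case
    by (intro exI[of _ "\<lambda>x v. f' x v * - sin (f x)"])
      (safe intro!: elementary.elementary_sin elementary.elementary_mult elementary_minus has_derivative_cos; simp)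
next
  case (elementary_exp f)
  then obtain f' where "\<And>x. (f has_derivative f' x) (at x)" "\<And>v. elementary (\<lambda>x. f' x v)"
    by metis
  with elementary_exp.hyps show ?case
    by (intro exI[of _ "\<lambda>x v. f' x v * exp (f x)"])
      (auto intro!: elementary.elementary_exp elementary.elementary_mult has_derivative_exp)
next
  case (elementary_inverse f)
  then obtain f' where "\<And>x. (f has_derivative f' x) (at x)" "\<And>v. elementary (\<lambda>x. f' x v)"
    by metis
  with elementary_inverse.hyps show ?case
    by (intro exI[of _ "\<lambda>x v. - (inverse (f x) * f' x v * inverse (f x))"])
      (auto intro!: elementary.elementary_inverse elementary.elementary_mult elementary_minus has_derivative_inverse)
next
  case (elementary_antiderivative F h i)
  have "((\<lambda>x. F (x $ i)) has_derivative (\<lambda>v. h (x $ i) * v $ i)) (at x)" for x :: "real ^ 'n"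
    using has_derivative_compose[OF bounded_linear_imp_has_derivative[OF bounded_linear_vec_nth]
        elementary_antiderivative(1)[unfolded has_field_derivative_def]] .
  moreover have "elementary (\<lambda>x. h (x $ i) * v $ i)" for v :: "real ^ 'n"
    using elementary_antiderivative(2) by (intro elementary_mult elementary_const)
  ultimately show ?case
    by (intro exI[of _ "\<lambda>x v. h (x $ i) * v $ i"] conjI allI)
qed

lemma elementary_continuous:
  assumes "elementary f"
  shows "continuous_on UNIV f"
  using elementary_has_derivative[OF assms]
  by (metis continuous_at_imp_continuous_on has_derivative_continuous)

lemma elementary_smooth:
  fixes f :: "real ^ 'n \<Rightarrow> real"
  assumes "elementary f"
  shows "smooth f"
proof -
  have Ck: "elementary f \<Longrightarrow> Ck k f" for k and f :: "real ^ 'n \<Rightarrow> real"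
  proof (induction k arbitrary: f)
    case 0
    then show ?case by (simp add: elementary_continuous)
  next
    case (Suc k)
    obtain f' where f': "\<And>x. (f has_derivative f' x) (at x)" "\<And>v. elementary (\<lambda>x. f' x v)"
      using elementary_has_derivative[OF Suc.prems] by blast
    then have "frechet_derivative f (at x) = f' x" for x
      by (metis frechet_derivative_at)
    with f' Suc.IH show ?case
      by (auto simp: differentiable_def)
  qed
  with assms show ?thesis by (simp add: smooth_def)
qed

section \<open>Periodic antiderivatives\<close>

text \<open>Subtracting the mean makes the increment over one period vanish, hence the
  antiderivative periodic. If it is normalised to vanish at -1, it is the difference of the integral
  of \<open>q\<close> from -1 to \<open>t\<close> and of the mean times \<open>t + 1\<close>. As
  \<open>q\<close> is nonnegative, both lie between 0 and the full integral, which therefore also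
  bounds the difference.\<close>

lemma periodic_antiderivative:
  fixes q :: "real \<Rightarrow> real"
  assumes cont: "continuous_on UNIV q" and per: "\<And>t. q (t + 2) = q t" and nonneg: "\<And>t. 0 \<le> q t"
  obtains P where "\<And>t. (P has_real_derivative q t - integral {-1..1} q / 2) (at t)"
    and "\<And>t. P (t + 2) = P t"
    and "\<And>t. t \<in> {-1..1} \<Longrightarrow> \<bar>P t\<bar> \<le> integral {-1..1} q"
proof -
  define A where "A = integral {-1..1} q / 2"
  have "\<exists>F. \<forall>x. -\<infinity> < ereal x \<longrightarrow> ereal x < \<infinity> \<longrightarrow> (F has_vector_derivative q x - A) (at x)"
    using cont by (intro einterval_antiderivative) (auto simp: continuous_on_eq_continuous_at)
  then obtain F where F: "\<And>t. (F has_real_derivative q t - A) (at t)"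
    by (auto simp: has_real_derivative_iff_has_vector_derivative)
  define P where "P = (\<lambda>t. F t - F (-1))"
  have P: "(P has_real_derivative q t - A) (at t)" for t
    unfolding P_def using F[of t] by (auto intro!: derivative_eq_intros)
  have qint: "q integrable_on {s..t}" for s t
    by (intro integrable_continuous_real continuous_on_subset[OF cont]) auto
  have P_eq: "P t = integral {-1..t} q - A * (t + 1)" if "-1 \<le> t" for t
  proof -
    have "((\<lambda>s. q s - A) has_integral P t - P (-1)) {-1..t}"
      using that P by (intro fundamental_theorem_of_calculus)
        (auto simp: has_real_derivative_iff_has_vector_derivative intro: has_vector_derivative_at_within)
    moreover have "((\<lambda>s. q s - A) has_integral integral {-1..t} q - A * (t + 1)) {-1..t}"
      using that by (intro has_integral_diff integrable_integral qint)
         (use has_integral_const_real[of A "-1" t] in \<open>simp add: mult.commute\<close>)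
    ultimately have "P t - P (-1) = integral {-1..t} q - A * (t + 1)"
      by (rule has_integral_unique)
    then show ?thesis by (simp add: P_def)
  qed
  have A2: "integral {-1..1} q = 2 * A" by (simp add: A_def)
  have "P (t + 2) = P t" for t
  proof -
    \<comment> \<open>Periodicity of \<open>q\<close> makes the increment over a period constant;
      its value at -1 is the integral of \<open>q\<close> minus its mean over [-1,1], which is
      0.\<close>
    have "((\<lambda>t. P (t + 2) - P t) has_real_derivative 0) (at s)" for s
      using DERIV_diff[OF P[of "s + 2", unfolded DERIV_shift] P[of s]] by (simp add: per)
    then have "(\<lambda>t. P (t + 2) - P t) t = (\<lambda>t. P (t + 2) - P t) (-1)"
      by (rule DERIV_isconst_all[rule_format])
    also have "\<dots> = 0"
      using P_eq[of 1] P_eq[of "-1"] by (simp add: A2)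
    finally show ?thesis by simp
  qed
  moreover have "\<bar>P t\<bar> \<le> 2 * A" if "t \<in> {-1..1}" for t
  proof -
    have "0 \<le> integral {-1..t} q" "integral {-1..t} q \<le> 2 * A"
      unfolding A2[symmetric] using that nonneg qint
      by (auto intro!: integral_nonneg integral_subset_le)
    moreover from this have "0 \<le> A * (t + 1)" "A * (t + 1) \<le> A * 2"
      using that by (auto intro!: mult_left_mono)
    ultimately show ?thesis
      using P_eq[of t] that by (simp only: atLeastAtMost_iff)
  qed
  ultimately show ?thesis
    using that[of P] P unfolding A2 by simp
qed

section \<open>Smoothed indicator functions of intervals\<close>

text \<open>
  On \<open>[-1,1]\<close> the argument of the exponential is negative inside \<open>[a,b]\<close> and positive outside, so
  that the functions converge to the indicator function of \<open>[a,b]\<close> as \<open>m\<close> grows.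
\<close>

definition cutoff :: "real \<Rightarrow> real \<Rightarrow> nat \<Rightarrow> real \<Rightarrow> real" where
  "cutoff a b m t =
     inverse (1 + exp (real m * (cos (pi * ((b - a) / 2)) - cos (pi * (t - (a + b) / 2)))))"

lemma cutoff_pos: "0 < cutoff a b m t"
  and cutoff_le_1: "cutoff a b m t \<le> 1"
  by (simp_all add: cutoff_def inverse_le_1_iff add_pos_pos)

lemma cutoff_periodic: "cutoff a b m (t + 2) = cutoff a b m t"
proof -
  have "pi * (t + 2 - (a + b) / 2) = pi * (t - (a + b) / 2) + 2 * pi"
    by (simp add: algebra_simps)
  then show ?thesis
    unfolding cutoff_def by (metis cos_periodic)
qed

lemma elementary_cutoff: "elementary (\<lambda>x. cutoff a b m (x $ i))"
proof -
  have "elementary (\<lambda>x. pi * (x $ i - (a + b) / 2))"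
    by (rule elementary_mult[OF elementary_const elementary_diff[OF elementary_coord elementary_const]])
  then have "elementary (\<lambda>x. real m * (cos (pi * ((b - a) / 2)) - cos (pi * (x $ i - (a + b) / 2))))"
    by (rule elementary_mult[OF elementary_const elementary_diff[OF elementary_const elementary_cos]])
  then have "elementary (\<lambda>x. 1 + exp (real m * (cos (pi * ((b - a) / 2)) - cos (pi * (x $ i - (a + b) / 2)))))"
    by (rule elementary_add[OF elementary_const elementary_exp])
  then show ?thesis
    unfolding cutoff_def
    by (rule elementary_inverse)
      (rule add_pos_pos[OF zero_less_one exp_gt_zero, THEN less_imp_neq, THEN not_sym])
qed

lemma continuous_cutoff: "continuous_on UNIV (cutoff a b m)"
proof -
  have "1 + exp (real m * (cos (pi * ((b - a) / 2)) - cos (pi * (t - (a + b) / 2)))) \<noteq> 0" for t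
    by (rule add_pos_pos[OF zero_less_one exp_gt_zero, THEN less_imp_neq, THEN not_sym])
  then show ?thesis
    unfolding cutoff_def[abs_def] by (intro continuous_intros) auto
qed

text \<open>The limit is decided by the sign of \<open>z\<close>. At \<open>a\<close> and
  \<open>b\<close> one has \<open>z = 0\<close> and the value is 1/2 for all \<open>m\<close>. The
  points -1 and 1 are left out as well, since periodicity identifies them: if \<open>b = 1\<close>,
  then \<open>z = 0\<close> also at \<open>t = -1\<close>.\<close>

lemma cutoff_tendsto:
  assumes ab: "-1 \<le> a" "a \<le> b" "b \<le> 1" and t: "t \<in> {-1..1}" "t \<notin> {a, b, -1, 1}"
  shows "(\<lambda>m. cutoff a b m t) \<longlonglongrightarrow> indicator {a..b} t"
proof -
  define c where "c = (a + b) / 2"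
  define r where "r = (b - a) / 2"
  have ab_eq: "a = c - r" "b = c + r"
    by (simp_all add: c_def r_def field_simps)
  define z where "z = cos (pi * r) - cos (pi * (t - c))"
  have eq: "cutoff a b m t = inverse (1 + exp (real m * z))" for m
    by (simp add: cutoff_def z_def c_def r_def)
  have cos_abs: "cos (pi * (t - c)) = cos (pi * \<bar>t - c\<bar>)"
    by (simp add: abs_if) (metis cos_minus minus_diff_eq mult_minus_right)
  show ?thesis
  proof (cases "t \<in> {a..b}")
    case True
    then have "\<bar>t - c\<bar> < r" "r \<le> 1"
      using t ab by (auto simp: ab_eq abs_if)
    then have "cos (pi * r) < cos (pi * \<bar>t - c\<bar>)"
      by (intro cos_monotone_0_pi) auto
    then have "z < 0" using cos_abs by (simp add: z_def)
    then have "filterlim (\<lambda>m. z * real m) at_bot sequentially"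
      using filterlim_real_sequentially by (rule filterlim_tendsto_neg_mult_at_bot[OF tendsto_const])
    then have "(\<lambda>m. exp (real m * z)) \<longlonglongrightarrow> 0"
      using filterlim_compose[OF exp_at_bot] by (simp add: mult.commute)
    then have "(\<lambda>m. inverse (1 + exp (real m * z))) \<longlonglongrightarrow> inverse (1 + 0)"
      by (intro tendsto_intros) auto
    then show ?thesis using True by (simp add: eq)
  next
    case False
    have "cos (pi * \<bar>t - c\<bar>) < cos (pi * r)"
    proof (cases "\<bar>t - c\<bar> \<le> 1")
      case True
      have "r < \<bar>t - c\<bar>" "0 \<le> r"
        using False t ab by (auto simp: ab_eq abs_if)
      with True show ?thesis
        by (intro cos_monotone_0_pi) auto
    next
      case far: False
      \<comment> \<open>Beyond distance 1 from the centre, the distance on the circle of length 2 is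
        \<open>2 - \<bar>t - c\<bar>\<close>. This brings the argument of the cosine back to
        [0, pi], where it is decreasing.\<close>
      have "pi * (2 - \<bar>t - c\<bar>) = 2 * pi - pi * \<bar>t - c\<bar>"
        by (simp add: right_diff_distrib)
      then have "cos (pi * \<bar>t - c\<bar>) = cos (pi * (2 - \<bar>t - c\<bar>))"
        by (simp only: cos_2pi_minus)
      also have "\<dots> < cos (pi * r)"
      proof (intro cos_monotone_0_pi)
        have "r < 2 - \<bar>t - c\<bar>"
          using t ab by (auto simp: ab_eq abs_if)
        then show "pi * r < pi * (2 - \<bar>t - c\<bar>)" by simp
        show "0 \<le> pi * r" using ab by (simp add: ab_eq)
        have "2 - \<bar>t - c\<bar> \<le> 1" using far by linarith
        from mult_left_mono[OF this, of pi] show "pi * (2 - \<bar>t - c\<bar>) \<le> pi" by simp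
      qed
      finally show ?thesis .
    qed
    then have "0 < z" using cos_abs by (simp add: z_def)
    then have "filterlim (\<lambda>m. z * real m) at_top sequentially"
      using filterlim_real_sequentially by (rule filterlim_tendsto_pos_mult_at_top[OF tendsto_const])
    then have "filterlim (\<lambda>m. exp (real m * z)) at_top sequentially"
      using filterlim_compose[OF exp_at_top] by (simp add: mult.commute)
    then have "filterlim (\<lambda>m. 1 + exp (real m * z)) at_top sequentially"
      by (rule filterlim_tendsto_add_at_top[OF tendsto_const])
    then have "(\<lambda>m. inverse (1 + exp (real m * z))) \<longlonglongrightarrow> 0"
      by (rule tendsto_inverse_0_at_top)
    then show ?thesis using False by (simp add: eq)
  qed
qed

section \<open>Testing the weak gradient\<close>

lemma pbox_borel [measurable]: "(pbox :: (real ^ 'n) set) \<in> sets borel"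
proof -
  have eq: "pbox = (\<Inter>i::'n. {x. -1 \<le> x $ i} \<inter> {x. x $ i < 1})"
    by (auto simp: pbox_def)
  have "closed {x :: real ^ 'n. -1 \<le> x $ i}" "open {x :: real ^ 'n. x $ i < 1}" for i
    by (intro closed_Collect_le open_Collect_less continuous_intros)+
  then have "{x :: real ^ 'n. -1 \<le> x $ i} \<inter> {x. x $ i < 1} \<in> sets borel" for i
    by (intro sets.Int borel_closed borel_open)
  then show ?thesis
    unfolding eq by (intro sets.countable_INT'') auto
qed

lemma pbox_sets_lebesgue [measurable]: "pbox \<in> sets lebesgue"
  using pbox_borel by (intro sets_completionI_sets) simp

lemma pbox_subset_cbox: "pbox \<subseteq> cbox (vec (-1)) (vec 1)"
  by (auto simp: pbox_def mem_box_cart less_imp_le)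

lemma negligible_coordinate_hyperplane: "negligible {x :: real ^ 'n. x $ i = c}"
  unfolding cart_eq_inner_axis by (rule negligible_standard_hyperplane) simp

text \<open>\<open>h\<close> is bounded on the compact closed box containing \<open>pbox\<close>, so
  the product is dominated by a multiple of \<open>f\<close>.\<close>

lemma set_integrable_mult_continuous:
  fixes f h :: "real ^ 'n \<Rightarrow> real"
  assumes f: "set_integrable lebesgue pbox f" and h: "continuous_on UNIV h"
  shows "set_integrable lebesgue pbox (\<lambda>x. f x * h x)"
proof -
  have "compact (h ` cbox (vec (-1)) (vec 1))"
    by (intro compact_continuous_image continuous_on_subset[OF h]) auto
  then obtain B where B: "\<And>x. x \<in> cbox (vec (-1)) (vec 1) \<Longrightarrow> \<bar>h x\<bar> \<le> B"
    using compact_imp_bounded bounded_iff by (metis image_eqI real_norm_def)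
  have hm: "h \<in> borel_measurable lebesgue"
    using borel_measurable_continuous_onI[OF h] by (intro measurable_completion) simp
  have fm: "(\<lambda>x. indicator pbox x *\<^sub>R f x) \<in> borel_measurable lebesgue"
    using f unfolding set_integrable_def by (rule borel_measurable_integrable)
  show ?thesis
    unfolding set_integrable_def
  proof (rule Bochner_Integration.integrable_bound)
    show "integrable lebesgue (\<lambda>x. B *\<^sub>R (indicator pbox x *\<^sub>R f x))"
      using f unfolding set_integrable_def by simp
    have "(\<lambda>x. (indicator pbox x *\<^sub>R f x) * h x) \<in> borel_measurable lebesgue"
      using fm hm by (rule borel_measurable_times)
    then show "(\<lambda>x. indicator pbox x *\<^sub>R (f x * h x)) \<in> borel_measurable lebesgue"
      by (simp add: mult.assoc)
    show "AE x in lebesgue. norm (indicator pbox x *\<^sub>R (f x * h x)) \<le> norm (B *\<^sub>R (indicator pbox x *\<^sub>R f x))"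
    proof (intro AE_I2)
      fix x :: "real ^ 'n"
      show "norm (indicator pbox x *\<^sub>R (f x * h x)) \<le> norm (B *\<^sub>R (indicator pbox x *\<^sub>R f x))"
      proof (cases "x \<in> pbox")
        case True
        then have "\<bar>h x\<bar> \<le> B" using B pbox_subset_cbox by blast
        then have "\<bar>h x\<bar> * \<bar>f x\<bar> \<le> \<bar>B\<bar> * \<bar>f x\<bar>"
          by (intro mult_right_mono) auto
        then show ?thesis using True by (simp add: abs_mult mult.commute)
      qed simp
    qed
  qed
qed

lemma set_integrable_L1_per_component:
  assumes "g \<in> L1_per"
  shows "set_integrable lebesgue pbox (\<lambda>x. g x $ i)"
    and "set_integrable lebesgue pbox (\<lambda>x. norm (g x))"
proof -
  have "integrable lebesgue (\<lambda>x. indicator pbox x *\<^sub>R g x)"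
    using assms by (simp add: L1_per_def set_integrable_def)
  from integrable_bounded_linear[OF bounded_linear_vec_nth[of i] this] integrable_norm[OF this]
  show "set_integrable lebesgue pbox (\<lambda>x. g x $ i)" "set_integrable lebesgue pbox (\<lambda>x. norm (g x))"
    by (simp_all add: set_integrable_def)
qed

text \<open>Tests with the product of \<open>R\<close> and a periodic antiderivative of \<open>q\<close> minus its mean.\<close>

lemma weak_gradient_bound:
  fixes u R :: "real ^ 'n \<Rightarrow> real" and q :: "real \<Rightarrow> real"
  assumes grad: "has_periodic_gradient u g"
    and u: "set_integrable lebesgue pbox u"
    and q: "continuous_on UNIV q" "\<And>t. q (t + 2) = q t" "\<And>t. 0 \<le> q t" "elementary (\<lambda>x :: real ^ 'n. q (x $ i))"
    and R: "elementary R" "periodic R" "\<And>x. 0 \<le> R x"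
    and R': "\<And>x R'. (R has_derivative R') (at x) \<Longrightarrow> R' (axis i 1) = 0"
  shows "\<bar>LINT x:pbox|lebesgue. u x * (q (x $ i) * R x)\<bar>
     \<le> integral {-1..1} q * (\<bar>LINT x:pbox|lebesgue. u x * R x\<bar> / 2 + (LINT x:pbox|lebesgue. norm (g x) * R x))"
proof -
  define J where "J = integral {-1..1} q"
  have J: "0 \<le> J" unfolding J_def using q
    by (intro integral_nonneg integrable_continuous_real continuous_on_subset[OF q(1)]) auto
  obtain P where P: "\<And>t. (P has_real_derivative q t - J / 2) (at t)"
    and Pper: "\<And>t. P (t + 2) = P t" and Pbound: "\<And>t. t \<in> {-1..1} \<Longrightarrow> \<bar>P t\<bar> \<le> J"
    by (rule periodic_antiderivative[OF q(1-3), folded J_def]) (rule that)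
  have g: "g \<in> L1_per" using grad by (simp add: has_periodic_gradient_def)
  define \<phi> where "\<phi> = (\<lambda>x. P (x $ i) * R x)"
  have "elementary (\<lambda>x :: real ^ 'n. P (x $ i))"
    by (rule elementary_antiderivative[OF P elementary_diff[OF q(4) elementary_const]])
  then have el: "elementary \<phi>"
    unfolding \<phi>_def by (rule elementary_mult[OF _ R(1)])
  have "P ((x + axis k 2) $ i) = P (x $ i)" for x k
    by (simp add: axis_def Pper)
  then have per: "periodic \<phi>"
    using R(2) by (simp add: periodic_def \<phi>_def)
  \<comment> \<open>In the product rule the term with the derivative of \<open>R\<close> drops out,
    as \<open>R\<close> is stationary in direction \<open>i\<close>.\<close>
  have D: "frechet_derivative \<phi> (at x) (axis i 1) = (q (x $ i) - J / 2) * R x" for x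
  proof -
    obtain R'' where R'': "(R has_derivative R'') (at x)"
      using elementary_has_derivative[OF R(1)] by blast
    have "((\<lambda>x. P (x $ i)) has_derivative (\<lambda>v. (q (x $ i) - J / 2) * v $ i)) (at x)"
      by (rule has_derivative_compose[OF bounded_linear_imp_has_derivative[OF bounded_linear_vec_nth]
        P[unfolded has_field_derivative_def]])
    from has_derivative_mult[OF this R''] have "frechet_derivative \<phi> (at x) =
         (\<lambda>v. P (x $ i) * R'' v + (q (x $ i) - J / 2) * v $ i * R x)"
      unfolding \<phi>_def by (rule frechet_derivative_at[symmetric])
    then show ?thesis using R'[OF R''] by (simp add: axis_def)
  qed
  have qc: "continuous_on UNIV (\<lambda>x. q (x $ i))" "continuous_on UNIV R" "continuous_on UNIV \<phi>"
    using q R el by (auto intro: elementary_continuous)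
  have int1: "set_integrable lebesgue pbox (\<lambda>x. u x * (q (x $ i) * R x))"
    and int2: "set_integrable lebesgue pbox (\<lambda>x. u x * R x)"
    and int3: "set_integrable lebesgue pbox (\<lambda>x. g x $ i * \<phi> x)"
    and int4: "set_integrable lebesgue pbox (\<lambda>x. norm (g x) * R x)"
    using u qc set_integrable_L1_per_component[OF g]
    by (auto intro!: set_integrable_mult_continuous continuous_on_mult)
  \<comment> \<open>The weak gradient tested with \<phi>. The mean \<open>J / 2\<close>, forced by
    periodicity, is the origin of the extra term with the integral of
    \<open>u x * R x\<close>.\<close>
  have "(LINT x:pbox|lebesgue. u x * ((q (x $ i) - J / 2) * R x)) = - (LINT x:pbox|lebesgue. g x $ i * \<phi> x)"
    using grad elementary_smooth[OF el] per unfolding has_periodic_gradient_def D[symmetric] by blast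
  moreover have "(LINT x:pbox|lebesgue. u x * ((q (x $ i) - J / 2) * R x)) =
     (LINT x:pbox|lebesgue. u x * (q (x $ i) * R x) - J / 2 * (u x * R x))"
    by (intro arg_cong2[where f=set_lebesgue_integral] arg_cong3[where f=set_lebesgue_integral] ext refl) (simp add: algebra_simps)
  moreover have "\<dots> = (LINT x:pbox|lebesgue. u x * (q (x $ i) * R x)) - J / 2 * (LINT x:pbox|lebesgue. u x * R x)"
    using int1 int2 by (subst set_integral_diff) (auto simp: set_integrable_mult_right)
  \<comment> \<open>On the box the antiderivative is at most \<open>J\<close>, so the gradient term
    gets a factor proportional to the mass of \<open>q\<close>; for smoothed indicators this becomes
    the length of the interval.\<close>
  moreover have "\<bar>LINT x:pbox|lebesgue. g x $ i * \<phi> x\<bar> \<le> J * (LINT x:pbox|lebesgue. norm (g x) * R x)"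
  proof -
    have "\<bar>LINT x:pbox|lebesgue. g x $ i * \<phi> x\<bar> \<le> (LINT x:pbox|lebesgue. \<bar>g x $ i * \<phi> x\<bar>)"
      using set_integral_norm_bound[OF int3] by simp
    also have "\<dots> \<le> (LINT x:pbox|lebesgue. J * (norm (g x) * R x))"
    proof (rule set_integral_mono)
      show "set_integrable lebesgue pbox (\<lambda>x. \<bar>g x $ i * \<phi> x\<bar>)"
        using set_integrable_abs[OF int3] .
      show "set_integrable lebesgue pbox (\<lambda>x. J * (norm (g x) * R x))"
        using int4 by (rule set_integrable_mult_right)
      fix x :: "real ^ 'n" assume "x \<in> pbox"
      then have "x $ i \<in> {-1..1}" by (auto simp: pbox_def less_imp_le)
      then have "\<bar>g x $ i\<bar> * (\<bar>P (x $ i)\<bar> * R x) \<le> norm (g x) * (J * R x)"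
        using R(3) J by (intro mult_mono component_le_norm_cart Pbound) auto
      then show "\<bar>g x $ i * \<phi> x\<bar> \<le> J * (norm (g x) * R x)"
        using R(3)[of x] by (simp add: \<phi>_def abs_mult mult_ac)
    qed
    finally show ?thesis by simp
  qed
  ultimately have "\<bar>(LINT x:pbox|lebesgue. u x * (q (x $ i) * R x)) - J / 2 * (LINT x:pbox|lebesgue. u x * R x)\<bar>
      \<le> J * (LINT x:pbox|lebesgue. norm (g x) * R x)"
    by simp
  moreover have "\<bar>J / 2 * (LINT x:pbox|lebesgue. u x * R x)\<bar> = J * (\<bar>LINT x:pbox|lebesgue. u x * R x\<bar> / 2)"
    using J by (simp add: abs_mult)
  ultimately show ?thesis
    unfolding J_def[symmetric] by (simp only: distrib_left)
qed

lemma integral_cutoff_tendsto: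
  assumes ab: "-1 \<le> a" "a \<le> b" "b \<le> 1"
  shows "(\<lambda>m. integral {-1..1} (cutoff a b m)) \<longlonglongrightarrow> b - a"
proof -
  have int: "set_integrable lborel {-1..1} (cutoff a b m)" for m
    by (intro borel_integrable_atLeastAtMost' continuous_on_subset[OF continuous_cutoff]) auto
  then have eq: "integral {-1..1} (cutoff a b m) = (\<integral>t. indicator {-1..1} t *\<^sub>R cutoff a b m t \<partial>lborel)" for m
    using set_borel_integral_eq_integral(2)[OF int] by (simp add: set_lebesgue_integral_def)
  have "(\<lambda>m. \<integral>t. indicator {-1..1} t *\<^sub>R cutoff a b m t \<partial>lborel)
      \<longlonglongrightarrow> (\<integral>t. indicator {-1..1} t *\<^sub>R indicator {a..b} t \<partial>lborel)"
  proof (rule integral_dominated_convergence)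
    show "integrable lborel (indicator {-1..1} :: real \<Rightarrow> real)"
      by simp
    show "(\<lambda>t. indicator {-1..1} t *\<^sub>R cutoff a b m t) \<in> borel_measurable lborel" for m
      using int unfolding set_integrable_def by (rule borel_measurable_integrable)
    have "AE t in lborel. t \<notin> {a, b, -1, 1}"
      by (intro AE_not_in) (auto simp: null_sets_def emeasure_lborel_countable)
    then show "AE t in lborel. (\<lambda>m. indicator {-1..1} t *\<^sub>R cutoff a b m t)
        \<longlonglongrightarrow> indicator {-1..1} t *\<^sub>R indicator {a..b} t"
    proof eventually_elim
      case (elim t)
      then show ?case
        using cutoff_tendsto[OF ab, of t] by (cases "t \<in> {-1..1}") auto
    qed
    show "AE t in lborel. norm (indicator {-1..1} t *\<^sub>R cutoff a b m t) \<le> indicator {-1..1} t" for m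
      using less_imp_le[OF cutoff_pos[of a b m]] cutoff_le_1[of a b m] by (auto simp: indicator_def abs_of_nonneg)
  qed auto
  moreover have "(\<lambda>t. indicator {-1..1} t *\<^sub>R indicator {a..b} t) = (indicator {a..b} :: real \<Rightarrow> real)"
    using ab by (auto simp: indicator_def)
  ultimately show ?thesis
    using ab by (simp add: eq)
qed

text \<open>Dominated convergence: the product of cutoffs lies in [0,1], so
  \<open>\<bar>f\<bar>\<close> dominates, and pointwise convergence can fail only on finitely many
  coordinate hyperplanes. The index set \<open>I\<close> is a singleton for strips and a pair for
  rectangles.\<close>

lemma integral_mult_cutoff_tendsto:
  fixes f :: "real ^ 'n \<Rightarrow> real" and a b :: "real ^ 'n"
  assumes f: "set_integrable lebesgue pbox f"
    and ab: "\<And>k. -1 \<le> a $ k" "\<And>k. a $ k \<le> b $ k" "\<And>k. b $ k \<le> 1"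
  shows "(\<lambda>m. LINT x:pbox|lebesgue. f x * (\<Prod>k\<in>I. cutoff (a $ k) (b $ k) m (x $ k)))
     \<longlonglongrightarrow> (LINT x:pbox|lebesgue. f x * (\<Prod>k\<in>I. indicator {a $ k..b $ k} (x $ k)))"
  unfolding set_lebesgue_integral_def
proof (rule integral_dominated_convergence)
  let ?f = "\<lambda>x. indicator pbox x *\<^sub>R f x"
  have f': "integrable lebesgue ?f" using f by (simp add: set_integrable_def)
  then show "integrable lebesgue (\<lambda>x. norm (?f x))" by simp
  have "continuous_on UNIV (\<lambda>x :: real ^ 'n. \<Prod>k\<in>I. cutoff (a $ k) (b $ k) m (x $ k))" for m
    by (intro continuous_intros continuous_on_compose2[OF continuous_cutoff]) auto
  from set_integrable_mult_continuous[OF f this]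
  show "(\<lambda>x. indicator pbox x *\<^sub>R (f x * (\<Prod>k\<in>I. cutoff (a $ k) (b $ k) m (x $ k)))) \<in> borel_measurable lebesgue" for m
    unfolding set_integrable_def by (rule borel_measurable_integrable)
  have "negligible (\<Union>k. \<Union>c\<in>{a $ k, b $ k, -1, 1}. {x :: real ^ 'n. x $ k = c})"
    by (intro negligible_Union) (auto intro!: negligible_Union negligible_coordinate_hyperplane)
  then have "AE x in lebesgue. x \<notin> (\<Union>k. \<Union>c\<in>{a $ k, b $ k, -1, 1}. {x :: real ^ 'n. x $ k = c})"
    by (intro AE_not_in) (simp add: negligible_iff_null_sets)
  then show lim: "AE x in lebesgue. (\<lambda>m. indicator pbox x *\<^sub>R (f x * (\<Prod>k\<in>I. cutoff (a $ k) (b $ k) m (x $ k))))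
      \<longlonglongrightarrow> indicator pbox x *\<^sub>R (f x * (\<Prod>k\<in>I. indicator {a $ k..b $ k} (x $ k)))"
  proof eventually_elim
    case (elim x)
    show ?case
    proof (cases "x \<in> pbox")
      case True
      then have "x $ k \<in> {-1..1}" for k
        by (auto simp: pbox_def less_imp_le)
      moreover have "x $ k \<notin> {a $ k, b $ k, -1, 1}" for k
        using elim by auto
      ultimately show ?thesis
        using ab by (intro tendsto_intros cutoff_tendsto) auto
    qed simp
  qed
  show "AE x in lebesgue. norm (indicator pbox x *\<^sub>R (f x * (\<Prod>k\<in>I. cutoff (a $ k) (b $ k) m (x $ k)))) \<le> norm (?f x)" for m
  proof (intro AE_I2)
    fix x :: "real ^ 'n"
    have "0 \<le> (\<Prod>k\<in>I. cutoff (a $ k) (b $ k) m (x $ k))"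
      by (intro prod_nonneg) (simp add: cutoff_pos less_imp_le)
    moreover have "(\<Prod>k\<in>I. cutoff (a $ k) (b $ k) m (x $ k)) \<le> 1"
      by (intro prod_le_1) (simp add: cutoff_pos less_imp_le cutoff_le_1)
    ultimately have "\<bar>f x\<bar> * \<bar>\<Prod>k\<in>I. cutoff (a $ k) (b $ k) m (x $ k)\<bar> \<le> \<bar>f x\<bar> * 1"
      by (intro mult_left_mono) auto
    then show "norm (indicator pbox x *\<^sub>R (f x * (\<Prod>k\<in>I. cutoff (a $ k) (b $ k) m (x $ k)))) \<le> norm (?f x)"
      by (simp add: abs_mult indicator_def)
  qed
  have "(\<lambda>x :: real ^ 'n. \<Prod>k\<in>I. indicator {a $ k..b $ k} (x $ k) :: real) \<in> borel_measurable borel"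
    by (intro borel_measurable_prod) measurable
  then have "(\<lambda>x. ?f x * (\<Prod>k\<in>I. indicator {a $ k..b $ k} (x $ k))) \<in> borel_measurable lebesgue"
    by (intro borel_measurable_times[OF borel_measurable_integrable[OF f']] measurable_completion) simp
  then show "(\<lambda>x. indicator pbox x *\<^sub>R (f x * (\<Prod>k\<in>I. indicator {a $ k..b $ k} (x $ k)))) \<in> borel_measurable lebesgue"
    by (simp add: mult.assoc)
qed

text \<open>Both estimates are proved for cutoffs and then passed to the limit. The first takes
  \<open>R = 1\<close>, for which the mean term vanishes because \<open>u\<close> has mean zero. The
  second takes for \<open>R\<close> a cutoff in coordinate \<open>j\<close>; its mean term is then
  controlled by the first estimate applied to that cutoff.\<close>

lemma box_integral_bound:
  fixes u :: "real ^ 'n \<Rightarrow> real" and a b :: "real ^ 'n"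
  assumes grad: "has_periodic_gradient u g"
    and u: "set_integrable lebesgue pbox u" "(LINT x:pbox|lebesgue. u x) = 0"
    and ab: "\<And>k. -1 \<le> a $ k" "\<And>k. a $ k \<le> b $ k" "\<And>k. b $ k \<le> 1"
  shows "\<bar>LINT x:pbox|lebesgue. u x * indicator {a $ i..b $ i} (x $ i)\<bar>
     \<le> (b $ i - a $ i) * (LINT x:pbox|lebesgue. norm (g x))"  (is ?one)
    and "i \<noteq> j \<Longrightarrow> \<bar>LINT x:pbox|lebesgue. u x * (indicator {a $ i..b $ i} (x $ i) * indicator {a $ j..b $ j} (x $ j))\<bar>
     \<le> (b $ i - a $ i) * ((b $ j - a $ j) * (LINT x:pbox|lebesgue. norm (g x)) / 2
          + (LINT x:pbox|lebesgue. norm (g x) * indicator {a $ j..b $ j} (x $ j)))" (is "_ \<Longrightarrow> ?two")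
proof -
  define N where "N = (LINT x:pbox|lebesgue. norm (g x))"
  define q where "q = (\<lambda>k m t. cutoff (a $ k) (b $ k) m t)"
  note q_props = continuous_cutoff cutoff_periodic less_imp_le[OF cutoff_pos] elementary_cutoff
  have g: "set_integrable lebesgue pbox (\<lambda>x. norm (g x))"
    using grad set_integrable_L1_per_component by (auto simp: has_periodic_gradient_def)
  have J: "(\<lambda>m. integral {-1..1} (q k m)) \<longlonglongrightarrow> b $ k - a $ k" for k
    unfolding q_def using integral_cutoff_tendsto ab by simp
  have single: "\<bar>LINT x:pbox|lebesgue. u x * q k m (x $ k)\<bar> \<le> integral {-1..1} (q k m) * N" for k m
  proof -
    have R': "R' (axis k 1) = 0" if "((\<lambda>x :: real ^ 'n. 1 :: real) has_derivative R') (at x)" for x R'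
      using has_derivative_unique[OF that has_derivative_const] by simp
    have "\<bar>LINT x:pbox|lebesgue. u x * (q k m (x $ k) * 1)\<bar>
       \<le> integral {-1..1} (q k m) * (\<bar>LINT x:pbox|lebesgue. u x * 1\<bar> / 2 + (LINT x:pbox|lebesgue. norm (g x) * 1))"
      unfolding q_def
      by (rule weak_gradient_bound[where q = "cutoff (a $ k) (b $ k) m" and R = "\<lambda>x. 1" and i = k,
          OF grad u(1) q_props elementary_const])
        (use R' in \<open>simp_all add: periodic_def\<close>)
    then show ?thesis using u(2) by (simp add: N_def)
  qed
  show ?one
  proof (rule LIMSEQ_le)
    show "(\<lambda>m. \<bar>LINT x:pbox|lebesgue. u x * q i m (x $ i)\<bar>)
        \<longlonglongrightarrow> \<bar>LINT x:pbox|lebesgue. u x * indicator {a $ i..b $ i} (x $ i)\<bar>"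
      using integral_mult_cutoff_tendsto[OF u(1) ab, of "{i}"] unfolding q_def
      by (intro tendsto_rabs) simp
    show "(\<lambda>m. integral {-1..1} (q i m) * N) \<longlonglongrightarrow> (b $ i - a $ i) * (LINT x:pbox|lebesgue. norm (g x))"
      unfolding N_def by (intro tendsto_intros J)
  qed (use single in auto)
  assume ij: "i \<noteq> j"
  have double: "\<bar>LINT x:pbox|lebesgue. u x * (q i m (x $ i) * q j m (x $ j))\<bar>
      \<le> integral {-1..1} (q i m) * (integral {-1..1} (q j m) * N / 2 + (LINT x:pbox|lebesgue. norm (g x) * q j m (x $ j)))" for m
  proof -
    have per: "periodic (\<lambda>x :: real ^ 'n. q j m (x $ j))"
      by (simp add: periodic_def q_def axis_def cutoff_periodic)
    \<comment> \<open>Along a line in direction \<open>i\<close> the coordinate \<open>j\<close>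
      does not change, so the restriction to this line is constant.\<close>
    have R': "R' (axis i 1) = 0" if R': "((\<lambda>x :: real ^ 'n. q j m (x $ j)) has_derivative R') (at x)" for x R'
    proof -
      have line: "((\<lambda>t. x + t *\<^sub>R axis i 1) has_derivative (\<lambda>t. t *\<^sub>R axis i 1)) (at 0)"
        by (auto intro!: derivative_eq_intros)
      have "((\<lambda>t. q j m ((x + t *\<^sub>R axis i 1) $ j)) has_derivative (\<lambda>t. R' (t *\<^sub>R axis i 1))) (at 0)"
        using R' by (intro has_derivative_compose[OF line]) simp
      moreover have "(\<lambda>t. q j m ((x + t *\<^sub>R axis i 1) $ j)) = (\<lambda>t. q j m (x $ j))"
        using ij by (simp add: axis_def)
      ultimately have "(\<lambda>t :: real. R' (t *\<^sub>R axis i 1)) = (\<lambda>t. 0)"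
        using has_derivative_unique[OF _ has_derivative_const] by metis
      from fun_cong[OF this, of 1] show ?thesis by simp
    qed
    have "\<bar>LINT x:pbox|lebesgue. u x * (q i m (x $ i) * q j m (x $ j))\<bar>
       \<le> integral {-1..1} (q i m) * (\<bar>LINT x:pbox|lebesgue. u x * q j m (x $ j)\<bar> / 2 + (LINT x:pbox|lebesgue. norm (g x) * q j m (x $ j)))"
      using per R' unfolding q_def
      by (intro weak_gradient_bound[where q = "cutoff (a $ i) (b $ i) m" and R = "\<lambda>x. cutoff (a $ j) (b $ j) m (x $ j)",
          OF grad u(1) q_props elementary_cutoff]) (auto simp: less_imp_le[OF cutoff_pos])
    \<comment> \<open>The single-coordinate bound in direction \<open>j\<close> replaces the mean
      term.\<close>
    also have "\<dots> \<le> integral {-1..1} (q i m) * (integral {-1..1} (q j m) * N / 2 + (LINT x:pbox|lebesgue. norm (g x) * q j m (x $ j)))"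
      using single[of j m] unfolding q_def
      by (intro mult_left_mono add_right_mono divide_right_mono integral_nonneg integrable_continuous_real
          continuous_on_subset[OF continuous_cutoff]) (auto simp: less_imp_le[OF cutoff_pos])
    finally show ?thesis .
  qed
  show ?two
  proof (rule LIMSEQ_le)
    show "(\<lambda>m. \<bar>LINT x:pbox|lebesgue. u x * (q i m (x $ i) * q j m (x $ j))\<bar>)
        \<longlonglongrightarrow> \<bar>LINT x:pbox|lebesgue. u x * (indicator {a $ i..b $ i} (x $ i) * indicator {a $ j..b $ j} (x $ j))\<bar>"
      using integral_mult_cutoff_tendsto[OF u(1) ab, of "{i, j}"] ij unfolding q_def
      by (intro tendsto_rabs) simp
    show "(\<lambda>m. integral {-1..1} (q i m) * (integral {-1..1} (q j m) * N / 2 + (LINT x:pbox|lebesgue. norm (g x) * q j m (x $ j))))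
       \<longlonglongrightarrow> (b $ i - a $ i) * ((b $ j - a $ j) * (LINT x:pbox|lebesgue. norm (g x)) / 2
          + (LINT x:pbox|lebesgue. norm (g x) * indicator {a $ j..b $ j} (x $ j)))"
      unfolding N_def using integral_mult_cutoff_tendsto[OF g ab, of "{j}"]
      by (intro tendsto_intros J) (simp_all add: q_def)
  qed (use double in auto)
qed

section \<open>The Sobolev--Poincare inequality\<close>

text \<open>The hypothesis says that \<open>H - f\<close> and \<open>H + f\<close> have nonnegative
  integrals over all subboxes, so each is negative at most on a null set.\<close>

lemma AE_abs_le_if_box_integrals_le:
  fixes f H :: "'a::euclidean_space \<Rightarrow> real"
  assumes f: "integrable lebesgue f" and H: "integrable lebesgue H"
    and le: "\<And>c d. \<lbrakk>cbox c d \<subseteq> cbox a b; cbox c d \<noteq> {}\<rbrakk>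
        \<Longrightarrow> \<bar>LINT x:cbox c d|lebesgue. f x\<bar> \<le> (LINT x:cbox c d|lebesgue. H x)"
  shows "AE x in lebesgue. x \<in> cbox a b \<longrightarrow> \<bar>f x\<bar> \<le> H x"
proof -
  have set_int: "set_integrable lebesgue (cbox c d) f" "set_integrable lebesgue (cbox c d) H" for c d
    using f H unfolding set_integrable_def by (simp_all only: integrable_mult_indicator lmeasurable_cbox fmeasurableD)
  note int = set_lebesgue_integral_eq_integral[OF set_int(1)] set_lebesgue_integral_eq_integral[OF set_int(2)]
  have bound: "\<bar>integral (cbox c d) f\<bar> \<le> integral (cbox c d) H" if "cbox c d \<subseteq> cbox a b" for c d
    using le[OF that] by (cases "cbox c d = {}") (simp_all add: int)
  have "negligible {x \<in> cbox a b. H x - f x < 0}" "negligible {x \<in> cbox a b. H x + f x < 0}"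
  proof (rule_tac [!] negligible_negative_part)
    show "(\<lambda>x. H x - f x) integrable_on cbox a b" "(\<lambda>x. H x + f x) integrable_on cbox a b"
      using int by (auto intro: integrable_diff integrable_add)
    fix c d assume "cbox c d \<subseteq> cbox a b"
    from bound[OF this] show "0 \<le> integral (cbox c d) (\<lambda>x. H x - f x)" "0 \<le> integral (cbox c d) (\<lambda>x. H x + f x)"
      using int by (simp_all add: integral_diff integral_add)
  qed
  then have "{x \<in> cbox a b. H x - f x < 0} \<union> {x \<in> cbox a b. H x + f x < 0} \<in> null_sets lebesgue"
    unfolding negligible_iff_null_sets by (rule null_sets.Un)
  then have "AE x in lebesgue. x \<notin> {x \<in> cbox a b. H x - f x < 0} \<union> {x \<in> cbox a b. H x + f x < 0}"
    by (rule AE_not_in)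
  then show ?thesis
    by eventually_elim auto
qed

lemma cbox_vec_bounds:
  fixes c d :: "real ^ 'n"
  assumes "cbox c d \<subseteq> cbox (vec (-1)) (vec 1)" "cbox c d \<noteq> {}"
  shows "-1 \<le> c $ k" "c $ k \<le> d $ k" "d $ k \<le> 1"
proof -
  have "\<forall>k. c $ k \<le> d $ k"
    using assms(2) by (simp add: interval_ne_empty_cart)
  then have "c \<in> cbox c d" "d \<in> cbox c d" and cd: "c $ k \<le> d $ k"
    by (auto simp: mem_box_cart)
  then have "c \<in> cbox (vec (-1)) (vec 1)" "d \<in> cbox (vec (-1)) (vec 1)"
    using assms(1) by blast+
  then show "-1 \<le> c $ k" "c $ k \<le> d $ k" "d $ k \<le> 1"
    using cd by (auto simp: mem_box_cart)
qed

section \<open>Fubini's theorem for two coordinates\<close>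

context
  fixes i j :: "'n::finite"
  assumes ij: "i \<noteq> j" "UNIV = {i, j}"
begin

lemma all_index: "(\<forall>k. P k) \<longleftrightarrow> P i \<and> P j"
proof -
  have "(\<forall>k. P k) \<longleftrightarrow> (\<forall>k\<in>UNIV. P k)" by simp
  then show ?thesis unfolding ij(2) by simp
qed

text \<open>The inverse of the map sending \<open>x\<close> to the pair of \<open>x $ i\<close> and
  \<open>x $ j\<close>. The pair of indices is ordered; exchanging them makes the same lemmas
  integrate out the other coordinate.\<close>

definition pair_vec :: "real \<times> real \<Rightarrow> real ^ 'n" where
  "pair_vec p = (\<chi> k. if k = i then fst p else snd p)"

lemma pair_vec_nth [simp]: "pair_vec p $ i = fst p" "pair_vec p $ j = snd p"
  using ij by (auto simp: pair_vec_def)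

lemma continuous_pair_vec: "continuous_on UNIV pair_vec"
  unfolding pair_vec_def[abs_def]
proof (rule continuous_on_vec_lambda)
  show "continuous_on UNIV (\<lambda>p :: real \<times> real. if k = i then fst p else snd p)" for k
    by (cases "k = i") (simp_all add: continuous_on_fst continuous_on_snd)
qed

lemma pair_vec_measurable [measurable]: "pair_vec \<in> borel_measurable (lborel \<Otimes>\<^sub>M lborel)"
proof -
  have "pair_vec \<in> borel_measurable borel"
    by (rule borel_measurable_continuous_onI[OF continuous_pair_vec])
  then show ?thesis
    by (simp add: lborel_prod)
qed

text \<open>Lebesgue measure is determined by its values on open boxes, and the preimage of a box is
  a product of two intervals.\<close>

lemma lborel_eq_distr_pair_vec: "(lborel :: (real ^ 'n) measure) = distr (lborel \<Otimes>\<^sub>M lborel) borel pair_vec"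
proof (rule lborel_eqI)
  fix l u :: "real ^ 'n" assume le: "\<And>b. b \<in> Basis \<Longrightarrow> l \<bullet> b \<le> u \<bullet> b"
  have le': "l $ k \<le> u $ k" for k
    using le[of "axis k 1"] by (simp add: inner_axis)
  have "pair_vec -` box l u = {l $ i<..<u $ i} \<times> {l $ j<..<u $ j}"
    by (auto simp: mem_box_cart all_index)
  then have "emeasure (distr (lborel \<Otimes>\<^sub>M lborel) borel pair_vec) (box l u)
      = emeasure (lborel \<Otimes>\<^sub>M lborel) ({l $ i<..<u $ i} \<times> {l $ j<..<u $ j})"
    by (subst emeasure_distr) (auto simp: space_pair_measure)
  also have "\<dots> = ennreal (u $ i - l $ i) * ennreal (u $ j - l $ j)"
    using le' by (subst lborel.emeasure_pair_measure_Times) auto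
  also have "\<dots> = ennreal ((u $ i - l $ i) * (u $ j - l $ j))"
    using le' by (simp add: ennreal_mult)
  also have "(u $ i - l $ i) * (u $ j - l $ j) = (\<Prod>b\<in>Basis. (u - l) \<bullet> b)"
  proof -
    have "Basis = {axis i 1, axis j (1::real)}"
      using ij by (auto simp: Basis_vec_def)
    moreover have "axis i (1::real) \<noteq> axis j 1"
      using ij(1) by (simp add: axis_eq_axis)
    ultimately show ?thesis
      unfolding \<open>Basis = _\<close> by (simp add: inner_axis)
  qed
  finally show "emeasure (distr (lborel \<Otimes>\<^sub>M lborel) borel pair_vec) (box l u) = (\<Prod>b\<in>Basis. (u - l) \<bullet> b)" .
qed simp

lemma
  fixes h :: "real ^ 'n \<Rightarrow> real"
  assumes h: "h \<in> borel_measurable borel"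
  shows integrable_pair_vec_iff: "integrable lborel h \<longleftrightarrow> integrable (lborel \<Otimes>\<^sub>M lborel) (\<lambda>p. h (pair_vec p))"
    and integral_pair_vec: "integral\<^sup>L lborel h = (\<integral>p. h (pair_vec p) \<partial>(lborel \<Otimes>\<^sub>M lborel))"
proof -
  show "integrable lborel h \<longleftrightarrow> integrable (lborel \<Otimes>\<^sub>M lborel) (\<lambda>p. h (pair_vec p))"
    unfolding lborel_eq_distr_pair_vec using h by (intro integrable_distr_eq) auto
  show "integral\<^sup>L lborel h = (\<integral>p. h (pair_vec p) \<partial>(lborel \<Otimes>\<^sub>M lborel))"
    unfolding lborel_eq_distr_pair_vec using h by (intro integral_distr) auto
qed

lemma
  fixes p q :: "real \<Rightarrow> real"
  assumes p: "integrable lborel p" and q: "integrable lborel q"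
  shows integrable_coordinate_product: "integrable lborel (\<lambda>x :: real ^ 'n. p (x $ i) * q (x $ j))"
    and integral_coordinate_product:
      "(\<integral>x. p (x $ i) * q (x $ j) \<partial>(lborel :: (real ^ 'n) measure)) = integral\<^sup>L lborel p * integral\<^sup>L lborel q"
proof -
  have [measurable]: "p \<in> borel_measurable borel" "q \<in> borel_measurable borel"
    using borel_measurable_integrable[OF p] borel_measurable_integrable[OF q] by simp_all
  have [measurable]: "(\<lambda>x :: real ^ 'n. x $ k) \<in> borel_measurable borel" for k
    by (intro borel_measurable_continuous_onI continuous_intros)
  have meas: "(\<lambda>x :: real ^ 'n. p (x $ i) * q (x $ j)) \<in> borel_measurable borel"
    by measurable
  have int: "integrable (lborel \<Otimes>\<^sub>M lborel) (\<lambda>z. p (fst z) * q (snd z))"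
  proof (rule lborel_pair.Fubini_integrable)
    have "(\<lambda>x. \<integral>y. norm (p (fst (x, y)) * q (snd (x, y))) \<partial>lborel) = (\<lambda>x. \<bar>p x\<bar> * (\<integral>y. \<bar>q y\<bar> \<partial>lborel))"
      by (simp add: abs_mult)
    then show "integrable lborel (\<lambda>x. \<integral>y. norm (p (fst (x, y)) * q (snd (x, y))) \<partial>lborel)"
      using p by simp
  qed (use q in auto)
  then show "integrable lborel (\<lambda>x :: real ^ 'n. p (x $ i) * q (x $ j))"
    by (simp add: integrable_pair_vec_iff[OF meas])
  have "(\<integral>x. p (x $ i) * q (x $ j) \<partial>(lborel :: (real ^ 'n) measure)) = (\<integral>x. \<integral>y. p x * q y \<partial>lborel \<partial>lborel)"
    using lborel_pair.integral_fst'[OF int] by (simp add: integral_pair_vec[OF meas])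
  then show "(\<integral>x. p (x $ i) * q (x $ j) \<partial>(lborel :: (real ^ 'n) measure)) = integral\<^sup>L lborel p * integral\<^sup>L lborel q"
    by (simp add: mult.commute)
qed

text \<open>Integrating out coordinate \<open>i\<close> turns the measure with density
  \<open>h\<close> into one on the line, whose density gives the mass of every strip. With the norm
  of the gradient for \<open>h\<close>, this is the one-variable majorant sought.\<close>

lemma
  fixes h :: "real ^ 'n \<Rightarrow> real"
  assumes h: "integrable lborel h"
  shows integrable_partial_integral: "integrable lborel (\<lambda>t. \<integral>s. h (pair_vec (s, t)) \<partial>lborel)"
    and integral_partial_integral: "A \<in> sets borel \<Longrightarrow> (\<integral>x. h x * indicator A (x $ j) \<partial>lborel)
          = (\<integral>t. indicator A t * (\<integral>s. h (pair_vec (s, t)) \<partial>lborel) \<partial>lborel)"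
proof -
  have hm [measurable]: "h \<in> borel_measurable borel"
    using borel_measurable_integrable[OF h] by simp
  have [measurable]: "(\<lambda>x :: real ^ 'n. x $ k) \<in> borel_measurable borel" for k
    by (intro borel_measurable_continuous_onI continuous_intros)
  have int: "integrable (lborel \<Otimes>\<^sub>M lborel) (\<lambda>p. h (pair_vec p))"
    using h by (simp add: integrable_pair_vec_iff[OF hm])
  show "integrable lborel (\<lambda>t. \<integral>s. h (pair_vec (s, t)) \<partial>lborel)"
    using lborel_pair.integrable_snd[of "\<lambda>s t. h (pair_vec (s, t))"] int by (simp add: case_prod_beta')
  assume A [measurable]: "A \<in> sets borel"
  have int': "integrable (lborel \<Otimes>\<^sub>M lborel) (\<lambda>(s, t). indicator A t * h (pair_vec (s, t)))"
  proof (rule Bochner_Integration.integrable_bound[OF int])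
    have "(\<lambda>p. indicator A (snd p) * h (pair_vec p)) \<in> borel_measurable (lborel \<Otimes>\<^sub>M lborel)"
      by measurable
    then show "(\<lambda>(s, t). indicator A t * h (pair_vec (s, t))) \<in> borel_measurable (lborel \<Otimes>\<^sub>M lborel)"
      by (simp add: case_prod_beta')
  qed (auto simp: indicator_def)
  have "(\<lambda>x :: real ^ 'n. h x * indicator A (x $ j)) \<in> borel_measurable borel"
    by measurable
  from integral_pair_vec[OF this]
  have "(\<integral>x. h x * indicator A (x $ j) \<partial>lborel) = (\<integral>(s, t). indicator A t * h (pair_vec (s, t)) \<partial>(lborel \<Otimes>\<^sub>M lborel))"
    by (simp add: case_prod_beta' mult.commute)
  also have "\<dots> = (\<integral>t. \<integral>s. indicator A t * h (pair_vec (s, t)) \<partial>lborel \<partial>lborel)"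
    using lborel_pair.integral_snd[OF int'] by simp
  finally show "(\<integral>x. h x * indicator A (x $ j) \<partial>lborel)
          = (\<integral>t. indicator A t * (\<integral>s. h (pair_vec (s, t)) \<partial>lborel) \<partial>lborel)"
    by simp
qed

section \<open>Pointwise bounds from bounds on boxes\<close>

text \<open>In the rectangle estimate the bound is the length of the first interval times the
  integral of a fixed function \<open>G\<close> over the second one. Hence it is itself the integral
  over the rectangle of a function of \<open>x $ j\<close>, and the comparison passes to almost
  every point.\<close>

lemma AE_strip_bound:
  fixes u :: "real ^ 'n \<Rightarrow> real"
  assumes grad: "has_periodic_gradient u g"
    and u: "set_integrable lebesgue pbox u" "(LINT x:pbox|lebesgue. u x) = 0"
  obtains G where "integrable lborel G" "\<And>t. 0 \<le> G t" "integral\<^sup>L lborel G = 2 * (LINT x:pbox|lebesgue. norm (g x))"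
    "AE x in lebesgue. x \<in> pbox \<longrightarrow> \<bar>u x\<bar> \<le> G (x $ j)"
proof -
  define N where "N = (LINT x:pbox|lebesgue. norm (g x))"
  have N: "0 \<le> N" unfolding N_def set_lebesgue_integral_def by (intro Bochner_Integration.integral_nonneg) simp
  have gi: "integrable lebesgue (\<lambda>x. indicator pbox x * norm (g x))"
    using grad set_integrable_L1_per_component(2) by (auto simp: has_periodic_gradient_def set_integrable_def)
  \<comment> \<open>The norm of \<open>g\<close> is only Lebesgue measurable, while the Fubini
    lemmas are stated for \<open>lborel\<close>; a Borel function equal to it almost everywhere
    takes its place.\<close>
  obtain h' where h' [measurable]: "h' \<in> borel_measurable lborel"
    and "AE x in lborel. indicator pbox x * norm (g x) = h' x"
    using completion_ex_borel_measurable_real[OF borel_measurable_integrable[OF gi]] by blast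
  then have h'_eq: "AE x in lebesgue. indicator pbox x * norm (g x) = h' x"
    by (intro AE_completion)
  \<comment> \<open>The indicator and the absolute value make \<open>h\<close> nonnegative and zero
    off the box at every point, so that line integrals are nonnegative for every
    \<open>t\<close>.\<close>
  define h where "h = (\<lambda>x. indicator pbox x * \<bar>h' x\<bar>)"
  have [measurable]: "h \<in> borel_measurable lborel"
    unfolding h_def by (intro borel_measurable_times) auto
  have hm [measurable]: "h \<in> borel_measurable lebesgue" "h \<in> borel_measurable borel"
    by (auto intro: measurable_completion)
  have h_eq: "AE x in lebesgue. indicator pbox x * norm (g x) = h x"
    using h'_eq
  proof eventually_elim
    case (elim x)
    moreover from this have "0 \<le> h' x" by (metis indicator_pos_le mult_nonneg_nonneg norm_ge_zero)
    ultimately show ?case by (auto simp: h_def indicator_def split: if_splits)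
  qed
  have "integrable lebesgue h"
    using gi h_eq hm by (subst integrable_cong_AE[OF _ _ h_eq, symmetric]) auto
  then have hi: "integrable lborel h"
    by (simp add: integrable_completion)
  have h_int: "(LINT x:pbox|lebesgue. norm (g x) * indicator A (x $ j)) = (\<integral>x. h x * indicator A (x $ j) \<partial>lborel)"
    if "A \<in> sets borel" for A
  proof -
    have [measurable]: "(\<lambda>x :: real ^ 'n. indicator A (x $ j) :: real) \<in> borel_measurable borel"
      using that by measurable
    then have im: "(\<lambda>x :: real ^ 'n. indicator A (x $ j) :: real) \<in> borel_measurable lebesgue"
      by (intro measurable_completion) simp
    have "(LINT x:pbox|lebesgue. norm (g x) * indicator A (x $ j)) = (\<integral>x. h x * indicator A (x $ j) \<partial>lebesgue)"
      unfolding set_lebesgue_integral_def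
    proof (rule integral_cong_AE)
      show "AE x in lebesgue. indicator pbox x *\<^sub>R (norm (g x) * indicator A (x $ j)) = h x * indicator A (x $ j)"
        using h_eq by eventually_elim (simp flip: mult.assoc)
      have "(\<lambda>x. (indicator pbox x * norm (g x)) * indicator A (x $ j)) \<in> borel_measurable lebesgue"
        using borel_measurable_integrable[OF gi] im by (rule borel_measurable_times)
      then show "(\<lambda>x. indicator pbox x *\<^sub>R (norm (g x) * indicator A (x $ j))) \<in> borel_measurable lebesgue"
        by (simp add: mult.assoc)
    qed (use hm im in \<open>auto intro: borel_measurable_times\<close>)
    then show ?thesis
      by (subst (asm) integral_completion) auto
  qed
  \<comment> \<open>Here \<open>\<Gamma>\<close> is the line integral of \<open>h\<close> at height
    \<open>t\<close>, not the degeneracy set.\<close>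
  define \<Gamma> where "\<Gamma> = (\<lambda>t. \<integral>s. h (pair_vec (s, t)) \<partial>lborel)"
  have \<Gamma>i: "integrable lborel \<Gamma>"
    unfolding \<Gamma>_def by (rule integrable_partial_integral[OF hi])
  have \<Gamma>0: "0 \<le> \<Gamma> t" for t
    unfolding \<Gamma>_def by (intro Bochner_Integration.integral_nonneg) (simp add: h_def)
  have strip: "(LINT x:pbox|lebesgue. norm (g x) * indicator A (x $ j)) = (\<integral>t. indicator A t * \<Gamma> t \<partial>lborel)"
    if "A \<in> sets borel" for A
    unfolding h_int[OF that] \<Gamma>_def by (rule integral_partial_integral[OF hi that])
  \<comment> \<open>The two summands match the strip term and the mean term of the rectangle
    estimate. Over [-1,1] they contribute \<open>N\<close> and \<open>2 * N / 2\<close>, whence the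
    total \<open>2 * N\<close>.\<close>
  define G where "G = (\<lambda>t. indicator {-1..1} t * (\<Gamma> t + N / 2))"
  have Gi: "integrable lborel G"
  proof -
    have "integrable lborel (\<lambda>t. indicator {-1..1} t * \<Gamma> t)"
      using \<Gamma>i by (simp add: integrable_mult_indicator[where 'b=real, simplified])
    moreover have "integrable lborel (\<lambda>t :: real. indicator {-1..1} t * (N / 2))"
      by simp
    ultimately show ?thesis
      unfolding G_def distrib_left by (rule Bochner_Integration.integrable_add)
  qed
  have G_int: "(\<integral>t. indicator {c..d} t * G t \<partial>lborel)
     = (LINT x:pbox|lebesgue. norm (g x) * indicator {c..d} (x $ j)) + (d - c) * N / 2"
    if "-1 \<le> c" "c \<le> d" "d \<le> 1" for c d
  proof -
    have "(\<lambda>t. indicator {c..d} t * G t) = (\<lambda>t. indicator {c..d} t * \<Gamma> t + indicator {c..d} t * (N / 2))"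
      using that by (auto simp: G_def indicator_def algebra_simps)
    then have "(\<integral>t. indicator {c..d} t * G t \<partial>lborel) = (\<integral>t. indicator {c..d} t * \<Gamma> t \<partial>lborel) + (\<integral>t. indicator {c..d} t * (N / 2) \<partial>lborel)"
      using \<Gamma>i by (simp add: integrable_mult_indicator[where 'b=real, simplified])
    then show ?thesis using that by (simp add: strip)
  qed
  show thesis
  proof
    show "integrable lborel G" by (rule Gi)
    show "0 \<le> G t" for t using \<Gamma>0 N by (simp add: G_def)
    have "(\<lambda>t. indicator {-1..1} t * G t) = G" by (auto simp: G_def indicator_def)
    moreover have "(LINT x:pbox|lebesgue. norm (g x) * indicator {-1..1} (x $ j)) = N"
      unfolding N_def by (intro set_lebesgue_integral_cong) (auto simp: pbox_def less_imp_le)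
    ultimately show "integral\<^sup>L lborel G = 2 * (LINT x:pbox|lebesgue. norm (g x))"
      using G_int[of "-1" 1] by (simp add: N_def)
    \<comment> \<open>Cutting off in coordinate \<open>i\<close> makes the function of
      \<open>x $ j\<close> integrable over the plane without changing it on the box.\<close>
    define H :: "real ^ 'n \<Rightarrow> real" where "H = (\<lambda>x. indicator {-1..1} (x $ i) * G (x $ j))"
    have Hi: "integrable lborel H"
      unfolding H_def by (intro integrable_coordinate_product Gi) simp
    then have Hm: "H \<in> borel_measurable lborel" by (rule borel_measurable_integrable)
    have ui: "integrable lebesgue (\<lambda>x. indicator pbox x * u x)"
      using u(1) by (simp add: set_integrable_def)
    have "AE x in lebesgue. x \<in> cbox (vec (-1)) (vec 1) \<longrightarrow> \<bar>indicator pbox x * u x\<bar> \<le> H x"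
    proof (rule AE_abs_le_if_box_integrals_le)
      show "integrable lebesgue H" using Hi Hm by (simp add: integrable_completion)
      show "integrable lebesgue (\<lambda>x. indicator pbox x * u x)" by (rule ui)
      fix c d :: "real ^ 'n" assume cd: "cbox c d \<subseteq> cbox (vec (-1)) (vec 1)" "cbox c d \<noteq> {}"
      note b = cbox_vec_bounds[OF cd]
      have ind: "indicator (cbox c d) x = (indicator {c $ i..d $ i} (x $ i) * indicator {c $ j..d $ j} (x $ j) :: real)" for x
      proof -
        show ?thesis by (simp add: indicator_def mem_box_cart all_index)
      qed
      have "(LINT x:cbox c d|lebesgue. H x) = (\<integral>x. indicator {c $ i..d $ i} (x $ i) * (indicator {c $ j..d $ j} (x $ j) * G (x $ j)) \<partial>lebesgue)"
        unfolding set_lebesgue_integral_def ind H_def using b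
        by (intro Bochner_Integration.integral_cong refl) (auto simp: indicator_def intro: order_trans)
      also have "\<dots> = (\<integral>x. indicator {c $ i..d $ i} (x $ i) * (indicator {c $ j..d $ j} (x $ j) * G (x $ j)) \<partial>lborel)"
      proof (rule integral_completion)
        have [measurable]: "(\<lambda>x :: real ^ 'n. x $ k) \<in> borel_measurable borel" for k
          by (intro borel_measurable_continuous_onI continuous_intros)
        have [measurable]: "G \<in> borel_measurable borel" using borel_measurable_integrable[OF Gi] by simp
        have "(\<lambda>x :: real ^ 'n. indicator {c $ i..d $ i} (x $ i) * (indicator {c $ j..d $ j} (x $ j) * G (x $ j))) \<in> borel_measurable borel"
          by measurable
        then show "(\<lambda>x :: real ^ 'n. indicator {c $ i..d $ i} (x $ i) * (indicator {c $ j..d $ j} (x $ j) * G (x $ j))) \<in> borel_measurable lborel"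
          by simp
      qed
      also have "\<dots> = (d $ i - c $ i) * (\<integral>t. indicator {c $ j..d $ j} t * G t \<partial>lborel)"
        using b Gi by (subst integral_coordinate_product) (auto simp: integrable_mult_indicator[where 'b=real, simplified])
      finally have H_eq: "(LINT x:cbox c d|lebesgue. H x) = (d $ i - c $ i) * (\<integral>t. indicator {c $ j..d $ j} t * G t \<partial>lborel)" .
      have "(LINT x:cbox c d|lebesgue. indicator pbox x * u x) =
         (LINT x:pbox|lebesgue. u x * (indicator {c $ i..d $ i} (x $ i) * indicator {c $ j..d $ j} (x $ j)))"
        unfolding set_lebesgue_integral_def by (simp add: ind mult_ac)
      then show "\<bar>LINT x:cbox c d|lebesgue. indicator pbox x * u x\<bar> \<le> (LINT x:cbox c d|lebesgue. H x)"
        using box_integral_bound(2)[OF grad u b ij(1)] b unfolding H_eq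
        by (simp add: G_int N_def add.commute)
    qed
    then show "AE x in lebesgue. x \<in> pbox \<longrightarrow> \<bar>u x\<bar> \<le> G (x $ j)"
    proof eventually_elim
      case (elim x)
      then show ?case
        using pbox_subset_cbox by (auto simp: H_def indicator_def mem_box_cart)
    qed
  qed
qed

end

lemma integrable_indicator_cbox: "integrable lebesgue (indicator (cbox a b) :: 'a::euclidean_space \<Rightarrow> real)"
  using lmeasurable_cbox[of a b] by (simp add: fmeasurable_def)

text \<open>Boxes are intervals here, so the single-coordinate estimate already compares box
  integrals, with a constant as majorant.\<close>

lemma AE_bound_dim1:
  fixes u :: "real ^ 'n \<Rightarrow> real"
  assumes i: "UNIV = {i :: 'n}"
    and grad: "has_periodic_gradient u g"
    and u: "set_integrable lebesgue pbox u" "(LINT x:pbox|lebesgue. u x) = 0"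
  shows "AE x in lebesgue. x \<in> pbox \<longrightarrow> \<bar>u x\<bar> \<le> (LINT x:pbox|lebesgue. norm (g x))" (is "AE x in _. _ \<longrightarrow> _ \<le> ?N")
proof -
  let ?S = "cbox (vec (-1)) (vec 1) :: (real ^ 'n) set"
  define N where "N = ?N"
  have all: "(\<forall>k. P k) \<longleftrightarrow> P i" for P
  proof -
    have "(\<forall>k. P k) \<longleftrightarrow> (\<forall>k\<in>UNIV. P k)" by simp
    then show ?thesis unfolding i by simp
  qed
  have "AE x in lebesgue. x \<in> ?S \<longrightarrow> \<bar>indicator pbox x * u x\<bar> \<le> indicator ?S x * N"
  proof (rule AE_abs_le_if_box_integrals_le)
    show "integrable lebesgue (\<lambda>x. indicator pbox x * u x)"
      using u(1) by (simp add: set_integrable_def)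
    show "integrable lebesgue (\<lambda>x. indicator ?S x * N)"
      by (intro integrable_mult_left integrable_indicator_cbox)
    fix c d :: "real ^ 'n" assume cd: "cbox c d \<subseteq> ?S" "cbox c d \<noteq> {}"
    note b = cbox_vec_bounds[OF cd]
    have "(LINT x:cbox c d|lebesgue. indicator ?S x * N) = (LINT x:cbox c d|lebesgue. N)"
      using cd by (intro set_lebesgue_integral_cong) auto
    also have "\<dots> = measure lborel (cbox c d) * N"
      by (simp add: set_lebesgue_integral_def)
    also have "measure lborel (cbox c d) = d $ i - c $ i"
      using cd by (simp add: content_cbox_cart i)
    finally have H_eq: "(LINT x:cbox c d|lebesgue. indicator ?S x * N) = (d $ i - c $ i) * N" .
    have "(LINT x:cbox c d|lebesgue. indicator pbox x * u x) =
        (LINT x:pbox|lebesgue. u x * indicator {c $ i..d $ i} (x $ i))"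
      unfolding set_lebesgue_integral_def
      by (intro Bochner_Integration.integral_cong refl) (simp add: indicator_def mem_box_cart all)
    then show "\<bar>LINT x:cbox c d|lebesgue. indicator pbox x * u x\<bar> \<le> (LINT x:cbox c d|lebesgue. indicator ?S x * N)"
      using box_integral_bound(1)[OF grad u b, of i] unfolding H_eq by (simp only: N_def)
  qed
  then show ?thesis
    unfolding N_def[symmetric]
  proof eventually_elim
    case (elim x)
    then show ?case
      using pbox_subset_cbox by (auto simp: indicator_def)
  qed
qed

section \<open>From pointwise bounds to the square integral\<close>

text \<open>In dimension two the constant 4 is the product of the integrals \<open>2 * N\<close> of
  the two majorants. In dimension one the uniform bound \<open>N\<close> on a box of length 2 gives
  the constant 2.\<close>

lemma sobolev_poincare:
  fixes u :: "real ^ 'n \<Rightarrow> real"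
  assumes card: "CARD('n) \<in> {1, 2}"
    and grad: "has_periodic_gradient u g"
    and u: "set_integrable lebesgue pbox u" "(LINT x:pbox|lebesgue. u x) = 0"
  shows "(LINT x:pbox|lebesgue. (u x)\<^sup>2) \<le> 4 * (LINT x:pbox|lebesgue. norm (g x))\<^sup>2"
proof -
  define N where "N = (LINT x:pbox|lebesgue. norm (g x))"
  have ?thesis if True: "CARD('n) = 1"

  proof -
    from True obtain i :: 'n where i: "UNIV = {i}"
      by (metis card_1_singletonE)
    let ?S = "cbox (vec (-1)) (vec 1) :: (real ^ 'n) set"
    have "(LINT x:pbox|lebesgue. (u x)\<^sup>2) \<le> (\<integral>x. indicator ?S x * N\<^sup>2 \<partial>lebesgue)"
      unfolding set_lebesgue_integral_def
    proof (rule integral_mono_AE')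
      show "AE x in lebesgue. indicator pbox x *\<^sub>R (u x)\<^sup>2 \<le> indicator ?S x * N\<^sup>2"
        using AE_bound_dim1[OF i grad u, folded N_def]
      proof eventually_elim
        case (elim x)
        show ?case
        proof (cases "x \<in> pbox")
          case True
          with elim have "\<bar>u x\<bar>\<^sup>2 \<le> N\<^sup>2" by (intro power_mono) auto
          with True show ?thesis using pbox_subset_cbox by (auto simp: indicator_def)
        qed simp
      qed
      show "integrable lebesgue (\<lambda>x. indicator ?S x * N\<^sup>2)"
        by (intro integrable_mult_left integrable_indicator_cbox)
    qed auto
    also have "\<dots> = measure lborel ?S * N\<^sup>2" by simp
    also have "measure lborel ?S = 2"
    proof -
      have "?S \<noteq> {}" by (simp add: interval_ne_empty_cart)
      then show ?thesis by (simp add: content_cbox_cart True)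
    qed
    finally have "(LINT x:pbox|lebesgue. (u x)\<^sup>2) \<le> 2 * N\<^sup>2" .
    also have "\<dots> \<le> 4 * N\<^sup>2" by simp
    finally show ?thesis by (simp only: N_def)
  qed
  moreover have ?thesis if two: "CARD('n) = 2"
  proof -
    from two obtain i j :: 'n where ij: "i \<noteq> j" "UNIV = {i, j}"
      by (metis card_2_iff)
    \<comment> \<open>The reversed pair yields the strip bound for the other coordinate.\<close>
    then have ji: "j \<noteq> i" "UNIV = {j, i}" by auto
    obtain G where G: "integrable lborel G" "\<And>t. 0 \<le> G t" "integral\<^sup>L lborel G = 2 * N"
      "AE x in lebesgue. x \<in> pbox \<longrightarrow> \<bar>u x\<bar> \<le> G (x $ j)"
      by (rule AE_strip_bound[OF ij grad u, folded N_def]) (rule that)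
    obtain G' where G': "integrable lborel G'" "\<And>t. 0 \<le> G' t" "integral\<^sup>L lborel G' = 2 * N"
      "AE x in lebesgue. x \<in> pbox \<longrightarrow> \<bar>u x\<bar> \<le> G' (x $ i)"
      by (rule AE_strip_bound[OF ji grad u, folded N_def]) (rule that)
    note int = integrable_coordinate_product[OF ij G'(1) G(1)]
    have "(LINT x:pbox|lebesgue. (u x)\<^sup>2) \<le> (\<integral>x. G' (x $ i) * G (x $ j) \<partial>lebesgue)"
      unfolding set_lebesgue_integral_def
    proof (rule integral_mono_AE')
      show "integrable lebesgue (\<lambda>x. G' (x $ i) * G (x $ j))"
        using int borel_measurable_integrable[OF int] by (simp add: integrable_completion)
      show "AE x in lebesgue. indicator pbox x *\<^sub>R (u x)\<^sup>2 \<le> G' (x $ i) * G (x $ j)"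
        using G(4) G'(4)
      proof eventually_elim
        case (elim x)
        show ?case
        proof (cases "x \<in> pbox")
          case True
          with elim have "\<bar>u x\<bar> * \<bar>u x\<bar> \<le> G' (x $ i) * G (x $ j)"
            using G'(2) by (intro mult_mono) auto
          with True show ?thesis by (simp add: power2_eq_square)
        qed (simp add: G G')
      qed
    qed (simp add: G G')
    also have "\<dots> = (\<integral>x. G' (x $ i) * G (x $ j) \<partial>lborel)"
      using borel_measurable_integrable[OF int] by (rule integral_completion)
    also have "\<dots> = 2 * N * (2 * N)"
      using integral_coordinate_product[OF ij G'(1) G(1)] by (simp add: G G')
    finally show ?thesis by (simp add: power2_eq_square N_def)
  qed
  ultimately show ?thesis using card by auto
qed

text \<open>The box has finite measure and \<open>\<bar>t\<bar> \<le> 1 + t\<^sup>2\<close>.\<close>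

lemma set_integrable_if_L2_per:
  fixes u :: "real ^ 'n \<Rightarrow> real"
  assumes "u \<in> L2_per"
  shows "set_integrable lebesgue pbox u"
proof -
  have um: "u \<in> borel_measurable lebesgue" and u2: "integrable lebesgue (\<lambda>x. indicator pbox x * (u x)\<^sup>2)"
    using assms by (auto simp: L2_per_def set_integrable_def)
  have "(pbox :: (real ^ 'n) set) \<in> lmeasurable"
    by (rule fmeasurableI2[OF lmeasurable_cbox pbox_subset_cbox]) simp
  then have "integrable lebesgue (indicator pbox :: real ^ 'n \<Rightarrow> real)"
    by (simp add: fmeasurable_def)
  from Bochner_Integration.integrable_add[OF this u2]
  show ?thesis
    unfolding set_integrable_def
  proof (rule Bochner_Integration.integrable_bound)
    show "(\<lambda>x. indicator pbox x *\<^sub>R u x) \<in> borel_measurable lebesgue"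
      using um by (intro borel_measurable_scaleR borel_measurable_indicator) auto
    have "\<bar>t\<bar> \<le> 1 + t\<^sup>2" for t :: real
      using sum_power2_ge_zero[of "\<bar>t\<bar> - 1" 0] zero_le_power2[of "\<bar>t\<bar> - 1"] by (simp add: power2_diff)
    then show "AE x in lebesgue. norm (indicator pbox x *\<^sub>R u x) \<le> norm (indicator pbox x + indicator pbox x * (u x)\<^sup>2)"
      by (intro AE_I2) (auto simp: indicator_def abs_of_nonneg add_nonneg_nonneg)
  qed
qed

section \<open>Integrability of the inverse weight\<close>

text \<open>By the triangle inequality, enlarging the radius of every ball of a cover of
  \<open>\<Gamma>\<close> by \<open>e\<close> covers the \<open>e\<close>-neighbourhood.
  Nonemptiness matters, as \<open>infdist\<close> to the empty set is 0.\<close>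

lemma emeasure_infdist_less_le:
  fixes \<Gamma> :: "'a::euclidean_space set"
  assumes "finite F" "\<Gamma> \<subseteq> (\<Union>c\<in>F. ball c r)" "\<Gamma> \<noteq> {}" "0 \<le> r" "0 \<le> e"
  shows "emeasure lborel {x. infdist x \<Gamma> < e}
    \<le> ennreal (real (card F) * ((r + e) ^ DIM('a) * measure lborel (ball (0::'a) 1)))"
proof -
  have "{x. infdist x \<Gamma> < e} \<subseteq> (\<Union>c\<in>F. ball c (r + e))"
  proof
    fix x assume "x \<in> {x. infdist x \<Gamma> < e}"
    then have "(INF a\<in>\<Gamma>. dist x a) < e"
      using assms(3) by (simp add: infdist_notempty)
    then obtain y where y: "y \<in> \<Gamma>" "dist x y < e"
      using assms(3) by (subst (asm) cINF_less_iff) auto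
    then obtain c where "c \<in> F" "dist c y < r"
      using assms(2) by auto
    moreover from this y have "dist c x < r + e"
      using dist_triangle[of c x y] by (simp add: dist_commute)
    ultimately show "x \<in> (\<Union>c\<in>F. ball c (r + e))" by auto
  qed
  then have "emeasure lborel {x. infdist x \<Gamma> < e} \<le> emeasure lborel (\<Union>c\<in>F. ball c (r + e))"
    by (intro emeasure_mono) (simp_all add: borel_open open_UN)
  also have "\<dots> \<le> (\<Sum>c\<in>F. emeasure lborel (ball c (r + e)))"
    using assms(1) by (intro emeasure_subadditive_finite) auto
  also have "\<dots> = (\<Sum>c\<in>F. ennreal ((r + e) ^ DIM('a) * measure lborel (ball (0::'a) 1)))"
  proof (intro sum.cong refl)
    fix c :: 'a
    have "emeasure lborel (ball c (r + e)) = ennreal (measure lborel (ball c (r + e)))"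
      using emeasure_lborel_ball_finite[of c "r + e"] by (intro emeasure_eq_ennreal_measure) auto
    then show "emeasure lborel (ball c (r + e)) = ennreal ((r + e) ^ DIM('a) * measure lborel (ball (0::'a) 1))"
      using assms(4,5) content_ball_conv_unit_ball[of "r + e" c] by simp
  qed
  also have "\<dots> = ennreal (\<Sum>c\<in>F. (r + e) ^ DIM('a) * measure lborel (ball (0::'a) 1))"
    using assms(4,5) by (intro sum_ennreal) (auto intro!: mult_nonneg_nonneg)
  finally show ?thesis by simp
qed

text \<open>The mean value inequality, with the derivative bounded on the compact interval by
  continuity.\<close>

lemma smooth_curve_lipschitz:
  fixes \<gamma> :: "real \<Rightarrow> 'a::euclidean_space"
  assumes "smooth \<gamma>"
  obtains L where "0 \<le> L" "\<And>s t. \<lbrakk>s \<in> {0..1}; t \<in> {0..1}\<rbrakk> \<Longrightarrow> dist (\<gamma> s) (\<gamma> t) \<le> L * \<bar>s - t\<bar>"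
proof -
  have "Ck (Suc 0) \<gamma>" using assms by (simp only: smooth_def)
  then have diff: "\<And>t. \<gamma> differentiable (at t)"
    and cont: "continuous_on UNIV (\<lambda>t. frechet_derivative \<gamma> (at t) 1)"
    by simp_all
  have "compact ((\<lambda>t. frechet_derivative \<gamma> (at t) 1) ` {0..1})"
    by (intro compact_continuous_image continuous_on_subset[OF cont]) auto
  then have "bounded ((\<lambda>t. frechet_derivative \<gamma> (at t) 1) ` {0..1})"
    by (rule compact_imp_bounded)
  then obtain L where L: "\<And>t. t \<in> {0..1} \<Longrightarrow> norm (frechet_derivative \<gamma> (at t) 1) \<le> L"
    unfolding bounded_iff by blast
  have "norm (\<gamma> s - \<gamma> t) \<le> L * norm (s - t)" if "s \<in> {0..1}" "t \<in> {0..1}" for s t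
  proof (rule differentiable_bound[of "{0..1}" \<gamma> "\<lambda>t. frechet_derivative \<gamma> (at t)"])
    fix r :: real assume r: "r \<in> {0..1}"
    have D: "(\<gamma> has_derivative frechet_derivative \<gamma> (at r)) (at r)"
      using diff frechet_derivative_works by blast
    then show "(\<gamma> has_derivative frechet_derivative \<gamma> (at r)) (at r within {0..1})"
      by (rule has_derivative_at_withinI)
    show "onorm (frechet_derivative \<gamma> (at r)) \<le> L"
    proof (rule onorm_le)
      fix v :: real
      have "frechet_derivative \<gamma> (at r) v = v *\<^sub>R frechet_derivative \<gamma> (at r) 1"
        using linear_scale[OF has_derivative_linear[OF D], of v 1] by simp
      then show "norm (frechet_derivative \<gamma> (at r) v) \<le> L * norm v"
        using mult_left_mono[OF L[OF r] abs_ge_zero[of v]] by (simp add: mult.commute)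
    qed
  qed (use that in auto)
  moreover have "0 \<le> L" by (rule order_trans[OF norm_ge_zero L[of 0]]) simp
  ultimately show thesis using that[of L] by (simp add: dist_norm)
qed

text \<open>At scale \<open>1 / 2 ^ k\<close> two balls cover \<open>\<Gamma>\<close> in dimension
  one and about \<open>2 ^ k\<close> balls in dimension two, so in both cases the tube has measure
  of the order of its width. Dyadic widths suit the layer decomposition of the inverse
  weight.\<close>

lemma degeneracy_set_tube:
  fixes \<Gamma> :: "(real ^ 'n) set"
  assumes card: "CARD('n) \<in> {1, 2}" and deg: "degeneracy_set \<Gamma>"
  obtains C where "0 \<le> C" "\<And>k. emeasure lborel {x. infdist x \<Gamma> < 1 / 2 ^ k} \<le> ennreal (C / 2 ^ k)"
proof -
  define V where "V = measure lborel (ball (0 :: real ^ 'n) 1)"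
  have V: "0 \<le> V" by (simp add: V_def)
  from card consider "CARD('n) = 1" | "CARD('n) = 2" by auto
  then show thesis
  proof cases
    case 1
    then have \<Gamma>: "\<Gamma> = {vec (-1/2), vec (1/2)}"
      using deg by (simp add: degeneracy_set_def)
    have fin: "finite \<Gamma>" "\<Gamma> \<noteq> {}" "card \<Gamma> \<le> 2"
      unfolding \<Gamma> by (auto simp: card_insert_if)
    show thesis
    proof (rule that[of "2 * (2 * V)"])
      fix k :: nat
      have cover: "\<Gamma> \<subseteq> (\<Union>c\<in>\<Gamma>. ball c (1 / 2 ^ k))"
        by (intro subsetI UN_I) auto
      have "emeasure lborel {x. infdist x \<Gamma> < 1 / 2 ^ k} \<le> ennreal (real (card \<Gamma>) * ((1 / 2 ^ k + 1 / 2 ^ k) ^ 1 * V))"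
        using emeasure_infdist_less_le[OF fin(1) cover fin(2), of "1 / 2 ^ k"] 1 by (simp add: V_def)
      also have "\<dots> \<le> ennreal (2 * ((1 / 2 ^ k + 1 / 2 ^ k) ^ 1 * V))"
        using fin V by (intro ennreal_leI mult_right_mono) auto
      finally show "emeasure lborel {x. infdist x \<Gamma> < 1 / 2 ^ k} \<le> ennreal (2 * (2 * V) / 2 ^ k)"
        by simp
    qed (use V in simp)
  next
    case 2
    then obtain \<gamma> :: "real \<Rightarrow> real ^ 'n" where \<gamma>: "smooth \<gamma>" "\<Gamma> = \<gamma> ` {0..<1}"
      using deg by (auto simp: degeneracy_set_def smooth_closed_curve_def)
    obtain L where L: "0 \<le> L" "\<And>s t. \<lbrakk>s \<in> {0..1}; t \<in> {0..1}\<rbrakk> \<Longrightarrow> dist (\<gamma> s) (\<gamma> t) \<le> L * \<bar>s - t\<bar>"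
      by (rule smooth_curve_lipschitz[OF \<gamma>(1)]) (rule that)
    \<comment> \<open>There are at most \<open>n = 2 ^ k\<close> balls, one for each grid point of
      the parameter interval; radius \<open>(L + 1) / n\<close> enlarged by \<open>1 / n\<close>
      gives \<open>(L + 2) / n\<close>, whose square times \<open>n\<close> leaves
      \<open>(L + 2)\<^sup>2 / n\<close>.\<close>
    show thesis
    proof (rule that[of "(L + 2)\<^sup>2 * V"])
      fix k :: nat
      define n :: nat where "n = 2 ^ k"
      have n: "0 < real n" by (simp add: n_def)
      define F where "F = (\<lambda>m. \<gamma> (real m / real n)) ` {..<n}"
      have F: "finite F" "card F \<le> n"
        unfolding F_def using card_image_le[of "{..<n}"] by auto
      have cover: "\<Gamma> \<subseteq> (\<Union>c\<in>F. ball c ((L + 1) / n))"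
      proof
        fix y assume "y \<in> \<Gamma>"
        then obtain t where t: "0 \<le> t" "t < 1" "y = \<gamma> t" using \<gamma> by auto
        \<comment> \<open>The grid point just below \<open>t\<close> is within \<open>1 / n\<close>
          of it. The radius has \<open>L + 1\<close> instead of \<open>L\<close> so that the point
          falls into the open ball also when equality holds or \<open>L = 0\<close>.\<close>
        define m where "m = nat \<lfloor>t * n\<rfloor>"
        have m: "real m \<le> t * n" "t * n < real m + 1"
          unfolding m_def using t n by (simp_all add: of_nat_nat)
        have "t * n < 1 * real n" using t n by (intro mult_strict_right_mono) auto
        with m have "real m < real n" by simp
        have "\<bar>real m / n - t\<bar> \<le> 1 / n"
        proof -
          have "real m / n \<le> t" "t < (real m + 1) / n"
            using m n by (simp_all add: pos_divide_le_eq pos_less_divide_eq)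
          then show ?thesis by (simp add: add_divide_distrib)
        qed
        then have "L * \<bar>real m / n - t\<bar> \<le> L * (1 / n)"
          using L(1) by (rule mult_left_mono)
        moreover have "dist (\<gamma> (real m / n)) y \<le> L * \<bar>real m / n - t\<bar>"
          unfolding t(3) using t \<open>real m < real n\<close> n by (intro L) auto
        moreover have "L * (1 / n) < (L + 1) / n"
          using n by (simp add: divide_strict_right_mono)
        ultimately have "dist (\<gamma> (real m / n)) y < (L + 1) / n" by linarith
        then show "y \<in> (\<Union>c\<in>F. ball c ((L + 1) / n))"
          using \<open>real m < real n\<close> by (auto simp: F_def)
      qed
      have "\<Gamma> \<noteq> {}" using \<gamma> by auto
      then have "emeasure lborel {x. infdist x \<Gamma> < 1 / n} \<le> ennreal (real (card F) * (((L + 1) / n + 1 / n) ^ 2 * V))"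
        using emeasure_infdist_less_le[OF F(1) cover, of "1 / n"] 2 L n by (simp add: V_def)
      also have "\<dots> \<le> ennreal (real n * (((L + 1) / n + 1 / n) ^ 2 * V))"
        using F V by (intro ennreal_leI mult_right_mono) auto
      also have "real n * (((L + 1) / n + 1 / n) ^ 2 * V) = (L + 2)\<^sup>2 * V / n"
      proof -
        have "(L + 1) / n + 1 / n = (L + 2) / n" by (simp add: add_divide_distrib)
        then show ?thesis using n by (simp add: power_divide power2_eq_square)
      qed
      finally show "emeasure lborel {x. infdist x \<Gamma> < 1 / 2 ^ k} \<le> ennreal ((L + 2)\<^sup>2 * V / 2 ^ k)"
        by (simp add: n_def)
    qed (use V in simp)
  qed
qed

section \<open>Dyadic layers around the degeneracy set\<close>

text \<open>The zero set lies in every tube, and the measures of the tubes tend to 0. This has to be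
  known separately: since \<open>inverse 0 = 0\<close>, the integral of the inverse weight does not
  detect the zeros of the weight.\<close>

lemma AE_infdist_pos:
  fixes \<Gamma> :: "'a::euclidean_space set"
  assumes tube: "\<And>k. emeasure lborel {x. infdist x \<Gamma> < 1 / 2 ^ k} \<le> ennreal (C / 2 ^ k)"
  shows "AE x in lborel. 0 < infdist x \<Gamma>"
proof -
  have "closed {x. infdist x \<Gamma> = 0}"
    by (intro closed_Collect_eq continuous_intros)
  then have meas: "{x. infdist x \<Gamma> = 0} \<in> sets lborel" by simp
  have "emeasure lborel {x. infdist x \<Gamma> = 0} \<le> ennreal 0"
  proof (rule LIMSEQ_le_const)
    have "(\<lambda>k. C * (1 / 2) ^ k) \<longlonglongrightarrow> C * 0"
      by (intro tendsto_intros LIMSEQ_realpow_zero) auto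
    then have "(\<lambda>k. C / 2 ^ k) \<longlonglongrightarrow> 0"
      by (simp add: power_one_over)
    then show "(\<lambda>k. ennreal (C / 2 ^ k)) \<longlonglongrightarrow> ennreal 0"
      by (rule tendsto_ennrealI)
    have "emeasure lborel {x. infdist x \<Gamma> = 0} \<le> emeasure lborel {x. infdist x \<Gamma> < 1 / 2 ^ k}" for k
    proof (rule emeasure_mono)
      have "open {x. infdist x \<Gamma> < 1 / 2 ^ k}"
        by (intro open_Collect_less continuous_intros)
      then show "{x. infdist x \<Gamma> < 1 / 2 ^ k} \<in> sets lborel" by simp
    qed auto
    then show "\<exists>N. \<forall>k\<ge>N. emeasure lborel {x. infdist x \<Gamma> = 0} \<le> ennreal (C / 2 ^ k)"
      using tube order_trans by blast
  qed
  then have "{x. infdist x \<Gamma> = 0} \<in> null_sets lborel"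
    using meas by (simp add: null_sets_def)
  then have "AE x in lborel. x \<notin> {x. infdist x \<Gamma> = 0}"
    by (rule AE_not_in)
  then show ?thesis
    by eventually_elim (simp add: infdist_nonneg less_le)
qed

text \<open>If the distance lies between \<open>1 / 2 ^ Suc k\<close> and \<open>1 / 2 ^ k\<close>,
  its power with exponent -\<sigma> is at most \<open>2 powr (\<sigma> * real (Suc k))\<close>, so a
  single summand suffices. In the remaining cases the summand 1 is enough; where the distance is 0,
  the left side is 0 for \<sigma> nonzero and 1 for \<sigma> = 0.\<close>

lemma inverse_dist_pow_le:
  assumes "0 \<le> \<sigma>"
  shows "ennreal (inverse (dist_pow \<Gamma> \<sigma> x))
    \<le> 1 + (\<Sum>k. ennreal (2 powr (\<sigma> * real (Suc k))) * indicator {x. infdist x \<Gamma> < 1 / 2 ^ k} x)"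
proof -
  let ?d = "infdist x \<Gamma>"
  let ?f = "\<lambda>k. ennreal (2 powr (\<sigma> * real (Suc k))) * indicator {x. infdist x \<Gamma> < 1 / 2 ^ k} x"
  let ?s = "suminf ?f"
  have triv: "ennreal t \<le> 1 + ?s" if "t \<le> 1" for t
  proof -
    have "ennreal t \<le> 1" using ennreal_leI[OF that] by (simp only: ennreal_1)
    then show ?thesis
      by (rule add_increasing2[OF zero_le])
  qed
  consider "\<sigma> = 0" | "?d = 0" "\<sigma> \<noteq> 0" | "1 \<le> ?d" "\<sigma> \<noteq> 0" | "0 < ?d" "?d < 1" "\<sigma> \<noteq> 0"
    using infdist_nonneg[of x \<Gamma>] by linarith
  then show ?thesis
  proof cases
    case 3
    then have "1 \<le> ?d powr \<sigma>" using assms by (simp add: ge_one_powr_ge_zero)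
    with 3 show ?thesis by (intro triv) (simp add: dist_pow_def inverse_le_1_iff)
  next
    case 4
    \<comment> \<open>The first dyadic number not exceeding the distance. Its index is positive
      because the distance is below 1, and its predecessor \<open>k\<close> is the index of the
      layer.\<close>
    define n where "n = (LEAST n. (1 / 2) ^ n \<le> ?d)"
    obtain n0 where "(1 / 2) ^ n0 < ?d" using real_arch_pow_inv[OF 4(1), of "1 / 2"] by auto
    then have n: "(1 / 2) ^ n \<le> ?d"
      unfolding n_def by (rule LeastI[of "\<lambda>n. (1 / 2) ^ n \<le> ?d", OF less_imp_le])
    with 4 have "n \<noteq> 0" by (cases n) auto
    then obtain k where k: "n = Suc k" by (cases n) auto
    have "\<not> (1 / 2) ^ k \<le> ?d" using not_less_Least[of k "\<lambda>n. (1 / 2) ^ n \<le> ?d"] k by (simp add: n_def)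
    then have kd: "?d < 1 / 2 ^ k" by (simp add: power_one_over)
    have "inverse ?d \<le> inverse ((1 / 2) ^ n)"
      by (rule le_imp_inverse_le[OF n]) simp
    also have "inverse ((1 / 2) ^ n) = (2 :: real) ^ Suc k"
      unfolding k by (simp only: power_one_over inverse_eq_divide divide_divide_eq_right mult_1 div_by_1)
    finally have "inverse ?d \<le> 2 ^ Suc k" .
    then have "inverse ?d powr \<sigma> \<le> (2 ^ Suc k) powr \<sigma>"
      using 4 assms by (intro powr_mono2) auto
    also have "\<dots> = 2 powr (\<sigma> * real (Suc k))"
    proof -
      have "(2::real) ^ Suc k = 2 powr real (Suc k)"
        by (rule powr_realpow[symmetric]) simp
      then show ?thesis by (simp only: powr_powr mult.commute[of \<sigma>])
    qed
    finally have "inverse (dist_pow \<Gamma> \<sigma> x) \<le> 2 powr (\<sigma> * real (Suc k))"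
      using 4 by (simp add: dist_pow_def inverse_powr)
    then have "ennreal (inverse (dist_pow \<Gamma> \<sigma> x)) \<le> ennreal (2 powr (\<sigma> * real (Suc k)))"
      by (rule ennreal_leI)
    then have 1: "ennreal (inverse (dist_pow \<Gamma> \<sigma> x)) \<le> ?f k"
      using kd by (simp only: indicator_simps mem_Collect_eq mult_1_right)
    have 2: "F k \<le> suminf F" for F :: "nat \<Rightarrow> ennreal"
      using sum_le_suminf[OF summableI, of "{k}" F] by simp
    have 3: "suminf ?f \<le> 1 + suminf ?f"
      by (rule add_increasing[OF zero_le_one order_refl])
    show ?thesis
      by (rule order_trans[OF order_trans[OF 1 2[of ?f]] 3])
  qed (intro triv; simp add: dist_pow_def)+
qed

text \<open>Integrated layer by layer, the tube estimate turns the majorant into a geometric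
  series.\<close>

lemma nn_integral_inverse_dist_pow:
  fixes \<Gamma> :: "(real ^ 'n) set"
  assumes tube: "\<And>k. emeasure lborel {x. infdist x \<Gamma> < 1 / 2 ^ k} \<le> ennreal (C / 2 ^ k)"
    and C: "0 \<le> C" and \<sigma>: "0 \<le> \<sigma>" "\<sigma> < 1"
  shows "(\<integral>\<^sup>+x. ennreal (inverse (dist_pow \<Gamma> \<sigma> x)) * indicator pbox x \<partial>lborel) < \<infinity>"
proof -
  have [measurable]: "{x. infdist x \<Gamma> < 1 / 2 ^ k} \<in> sets borel" for k :: nat
    by (intro borel_open open_Collect_less continuous_intros)
  let ?f = "\<lambda>k x. ennreal (2 powr (\<sigma> * real (Suc k))) * indicator {x. infdist x \<Gamma> < 1 / 2 ^ k} x"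
  have "(\<integral>\<^sup>+x. ennreal (inverse (dist_pow \<Gamma> \<sigma> x)) * indicator pbox x \<partial>lborel)
      \<le> (\<integral>\<^sup>+x. indicator pbox x + (\<Sum>k. ?f k x) \<partial>lborel)"
  proof (rule nn_integral_mono)
    fix x
    show "ennreal (inverse (dist_pow \<Gamma> \<sigma> x)) * indicator pbox x \<le> indicator pbox x + (\<Sum>k. ?f k x)"
      using inverse_dist_pow_le[OF \<sigma>(1), of \<Gamma> x] by (simp add: indicator_def)
  qed
  also have "\<dots> = emeasure lborel (pbox :: (real ^ 'n) set) + (\<Sum>k. \<integral>\<^sup>+x. ?f k x \<partial>lborel)"
    by (subst nn_integral_add) (auto simp: nn_integral_suminf)
  also have "\<dots> < \<infinity>"
  proof -
    have "emeasure lborel (pbox :: (real ^ 'n) set) \<le> emeasure lborel (cbox (vec (-1)) (vec 1) :: (real ^ 'n) set)"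
      by (intro emeasure_mono pbox_subset_cbox) simp
    also have "\<dots> < \<infinity>" by (rule emeasure_lborel_cbox_finite)
    finally have 1: "emeasure lborel (pbox :: (real ^ 'n) set) < \<infinity>" .
    \<comment> \<open>The ratio of the series: a factor \<open>2 powr \<sigma>\<close> from the
      growth of the inverse weight and 1/2 from the shrinking tube. It is below 1 exactly because
      \<sigma> < 1.\<close>
    define r where "r = 2 powr (\<sigma> - 1)"
    have r: "0 < r" "r < 1" using \<sigma> by (simp_all add: r_def powr_less_one)
    have term_eq: "2 powr (\<sigma> * real (Suc k)) * (C / 2 ^ k) = C * 2 powr \<sigma> * r ^ k" for k
    proof -
      have "r ^ k = 2 powr ((\<sigma> - 1) * real k)"
        using powr_realpow[OF r(1), of k] by (simp add: r_def powr_powr)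
      also have "(\<sigma> - 1) * real k = \<sigma> * real k - real k"
        by (rule left_diff_distrib[of \<sigma> 1 "real k", simplified])
      also have "2 powr \<dots> = 2 powr (\<sigma> * real k) / 2 ^ k"
        by (simp add: powr_diff powr_realpow)
      finally have "r ^ k = 2 powr (\<sigma> * real k) / 2 ^ k" .
      moreover have "\<sigma> * real (Suc k) = \<sigma> + \<sigma> * real k"
        by (simp add: distrib_left)
      then have "2 powr (\<sigma> * real (Suc k)) = 2 powr \<sigma> * 2 powr (\<sigma> * real k)"
        by (simp only: powr_add)
      ultimately show ?thesis by simp
    qed
    have "(\<integral>\<^sup>+x. ?f k x \<partial>lborel) \<le> ennreal (C * 2 powr \<sigma> * r ^ k)" for k
    proof -
      have "(\<integral>\<^sup>+x. ?f k x \<partial>lborel) = ennreal (2 powr (\<sigma> * real (Suc k))) * emeasure lborel {x. infdist x \<Gamma> < 1 / 2 ^ k}"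
        by (simp add: nn_integral_cmult_indicator)
      also have "\<dots> \<le> ennreal (2 powr (\<sigma> * real (Suc k))) * ennreal (C / 2 ^ k)"
        by (intro mult_left_mono tube) simp
      also have "\<dots> = ennreal (C * 2 powr \<sigma> * r ^ k)"
        unfolding term_eq[symmetric] using C by (intro ennreal_mult[symmetric]) auto
      finally show ?thesis .
    qed
    then have "(\<Sum>k. \<integral>\<^sup>+x. ?f k x \<partial>lborel) \<le> (\<Sum>k. ennreal (C * 2 powr \<sigma> * r ^ k))"
      by (intro suminf_le summableI)
    also have "\<dots> = ennreal (\<Sum>k. C * 2 powr \<sigma> * r ^ k)"
      using C r by (intro suminf_ennreal2 summable_mult summable_geometric) auto
    also have "\<dots> < \<infinity>" by simp
    finally have 2: "(\<Sum>k. \<integral>\<^sup>+x. ?f k x \<partial>lborel) < \<infinity>" .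
    from 1 2 show ?thesis by simp
  qed
  finally show ?thesis .
qed

section \<open>The weighted inequality\<close>

theorem lemma3p5:
  fixes \<Gamma> :: "(real ^ 'n) set" and \<sigma> :: real and \<alpha> :: "real ^ 'n \<Rightarrow> real"
  assumes "CARD('n) \<in> {1, 2}"
    and "degeneracy_set \<Gamma>"
    and "0 \<le> \<sigma>" and "\<sigma> < 1"
    and "\<alpha> \<in> D_per \<Gamma> \<sigma>"
  shows "\<exists>c::real. \<forall>u \<in> H1_per_0 \<alpha>.
           L2_norm u \<le> c * L2_norm (\<lambda>x. sqrt (\<alpha> x) *\<^sub>R periodic_gradient u x)"
proof -
  define w where "w = dist_pow \<Gamma> \<sigma>"
  obtain C where C: "0 \<le> C" and tube: "\<And>k. emeasure lborel {x. infdist x \<Gamma> < 1 / 2 ^ k} \<le> ennreal (C / 2 ^ k)"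
    by (rule degeneracy_set_tube[OF assms(1,2)]) (rule that)
  obtain b where b: "1 \<le> b" "\<And>x. x \<in> pbox \<Longrightarrow> 1 / b * w x \<le> \<alpha> x"
    using assms(5) by (auto simp: D_per_def w_def)
  have \<alpha>0: "0 \<le> \<alpha> x" for x using assms(5) by (auto simp: D_per_def)
  have w0: "0 \<le> w x" for x by (simp add: w_def dist_pow_def)
  have w_meas: "w \<in> borel_measurable borel"
  proof -
    have "(\<lambda>x. infdist x \<Gamma>) \<in> borel_measurable borel"
      by (intro borel_measurable_continuous_onI continuous_intros)
    then show ?thesis unfolding w_def dist_pow_def[abs_def] by measurable
  qed
  then have w_leb [measurable]: "w \<in> borel_measurable lebesgue"
    by (intro measurable_completion) simp
  have "AE x in lborel. 0 < w x"
    using AE_infdist_pos[OF tube] by eventually_elim (simp add: w_def dist_pow_def)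
  then have w_pos: "AE x in lebesgue. 0 < w x" by (rule AE_completion)
  have "(\<integral>\<^sup>+x. ennreal (inverse (w x)) * indicator pbox x \<partial>lebesgue) < \<infinity>"
    using nn_integral_inverse_dist_pow[OF tube C assms(3,4)] by (simp add: nn_integral_completion w_def)
  then obtain K where K: "0 \<le> K" "(\<integral>\<^sup>+x. ennreal (inverse (w x)) * indicator pbox x \<partial>lebesgue) = ennreal K"
    by (auto simp: less_top_ennreal)
  \<comment> \<open>The witness is left open and becomes \<open>sqrt (4 * K * b)\<close>;
    \<open>K\<close> and \<open>b\<close> are fixed before \<open>u\<close> is introduced.\<close>
  show ?thesis
  proof (intro exI ballI)
    fix u assume u: "u \<in> H1_per_0 \<alpha>"
    define g where "g = periodic_gradient u"
    define N where "N = (LINT x:pbox|lebesgue. norm (g x))"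
    define A where "A = (LINT x:pbox|lebesgue. \<alpha> x * (norm (g x))\<^sup>2)"
    have "\<exists>g. has_periodic_gradient u g"
      using u by (simp add: H1_per_0_def H1_per_def)
    then have grad: "has_periodic_gradient u g"
      unfolding g_def periodic_gradient_def by (rule someI_ex)
    then have gi: "set_integrable lebesgue pbox (\<lambda>x. norm (g x))" and [measurable]: "g \<in> borel_measurable lebesgue"
      using set_integrable_L1_per_component by (auto simp: has_periodic_gradient_def L1_per_def)
    have Ai: "integrable lebesgue (\<lambda>x. indicator pbox x * (\<alpha> x * (norm (g x))\<^sup>2))"
      using u unfolding g_def by (simp add: H1_per_0_def H1_per_def set_integrable_def)
    have "(LINT x:pbox|lebesgue. (u x)\<^sup>2) \<le> 4 * N\<^sup>2"
      unfolding N_def using u grad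
      by (intro sobolev_poincare[OF assms(1)] set_integrable_if_L2_per) (auto simp: H1_per_0_def H1_per_def)
    moreover have "N\<^sup>2 \<le> K * (b * A)"
    proof -
      \<comment> \<open>Cauchy--Schwarz is applied with the explicit distance power
        \<open>w\<close>, whose measurability is at hand; \<alpha> enters only afterwards through
        its lower bound.\<close>
      let ?p = "\<lambda>x. ennreal (sqrt (inverse (w x))) * indicator pbox x"
      let ?q = "\<lambda>x. ennreal (sqrt (w x) * norm (g x)) * indicator pbox x"
      have N0: "0 \<le> N" unfolding N_def set_lebesgue_integral_def by (intro Bochner_Integration.integral_nonneg) simp
      have A0: "0 \<le> A" unfolding A_def set_lebesgue_integral_def
        using \<alpha>0 by (intro Bochner_Integration.integral_nonneg) simp
      have "ennreal N = (\<integral>\<^sup>+x. ennreal (indicator pbox x *\<^sub>R norm (g x)) \<partial>lebesgue)"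
        unfolding N_def set_lebesgue_integral_def
        using gi by (intro nn_integral_eq_integral[symmetric]) (auto simp: set_integrable_def)
      also have "\<dots> = (\<integral>\<^sup>+x. ?p x * ?q x \<partial>lebesgue)"
      proof (rule nn_integral_cong_AE)
        \<comment> \<open>Positivity of \<open>w\<close> is essential here: at a zero of
          \<open>w\<close> both factors on the right are 0, while \<open>norm (g x)\<close> need not
          be.\<close>
        show "AE x in lebesgue. ennreal (indicator pbox x *\<^sub>R norm (g x)) = ?p x * ?q x"
          using w_pos
        proof eventually_elim
          case (elim x)
          then have "sqrt (inverse (w x)) * (sqrt (w x) * norm (g x)) = norm (g x)"
            by (simp add: real_sqrt_inverse)
          with elim show ?case
            by (simp add: indicator_def ennreal_mult[symmetric])
        qed
      qed
      finally have "ennreal (N\<^sup>2) = (\<integral>\<^sup>+x. ?p x * ?q x \<partial>lebesgue)\<^sup>2"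
        by (simp only: ennreal_power[OF N0, symmetric])
      also have "\<dots> \<le> (\<integral>\<^sup>+x. (?p x)\<^sup>2 \<partial>lebesgue) * (\<integral>\<^sup>+x. (?q x)\<^sup>2 \<partial>lebesgue)"
        by (rule Cauchy_Schwarz_nn_integral) measurable
      also have "(\<integral>\<^sup>+x. (?p x)\<^sup>2 \<partial>lebesgue) = ennreal K"
        unfolding K(2)[symmetric] using w0
        by (intro nn_integral_cong) (simp add: indicator_def ennreal_power)
      \<comment> \<open>The lower bound on the weight gives \<open>w x \<le> b * \<alpha> x\<close>
        on the box.\<close>
      also have "(\<integral>\<^sup>+x. (?q x)\<^sup>2 \<partial>lebesgue) \<le> (\<integral>\<^sup>+x. ennreal (b * (indicator pbox x * (\<alpha> x * (norm (g x))\<^sup>2))) \<partial>lebesgue)"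
      proof (rule nn_integral_mono)
        fix x :: "real ^ 'n"
        show "(?q x)\<^sup>2 \<le> ennreal (b * (indicator pbox x * (\<alpha> x * (norm (g x))\<^sup>2)))"
        proof (cases "x \<in> pbox")
          case True
          then have "w x \<le> b * \<alpha> x" using b by (simp add: field_simps)
          then have "w x * (norm (g x))\<^sup>2 \<le> b * \<alpha> x * (norm (g x))\<^sup>2"
            by (rule mult_right_mono) simp
          with True w0 show ?thesis
            by (simp add: ennreal_power power_mult_distrib mult.assoc ennreal_leI)
        qed simp
      qed
      also have "\<dots> = ennreal (b * A)"
        unfolding A_def set_lebesgue_integral_def
        using Ai b \<alpha>0 by (subst nn_integral_eq_integral) auto
      finally have "ennreal (N\<^sup>2) \<le> ennreal K * ennreal (b * A)"
        by (simp add: mult_left_mono)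
      also have "\<dots> = ennreal (K * (b * A))"
        using K b A0 by (simp add: ennreal_mult)
      finally show ?thesis
        using K b A0 by (subst (asm) ennreal_le_iff) auto
    qed
    ultimately have "(LINT x:pbox|lebesgue. (u x)\<^sup>2) \<le> 4 * K * b * A" by simp
    then have "L2_norm u \<le> sqrt (4 * K * b * A)"
      by (simp add: L2_norm_def)
    also have "\<dots> = sqrt (4 * K * b) * sqrt A"
      by (rule real_sqrt_mult)
    also have "sqrt A = L2_norm (\<lambda>x. sqrt (\<alpha> x) *\<^sub>R periodic_gradient u x)"
      using \<alpha>0 by (simp add: L2_norm_def A_def g_def power_mult_distrib)
    finally show "L2_norm u \<le> sqrt (4 * K * b) * L2_norm (\<lambda>x. sqrt (\<alpha> x) *\<^sub>R periodic_gradient u x)" .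
  qed
qed

end
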